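(* Let $H$ be a graph containing a vertex whose removal makes $H$ acyclic. Then there is a constant $C>0$ (depending on $H$) such that $\lambda(n,H)\leq C n^{1/3}$ for all positive integers $n$ and $\mu(m,H)\leq C m^{1/5}$ for all positive integers $m$.
   Context: All graphs are finite and simple; $\bar G$ is the complement of $G$. A graph is $H$-free if it has no (not necessarily induced) subgraph isomorphic to $H$. The Lovász theta function $\vartheta(F)$ of a graph $F$ is the minimal real $\kappa\geq 2$ for which there exists a unit vector $\mathbf{x}_v$ in some Euclidean space for each vertex $v$ of $F$ such that $\langle \mathbf{x}_u,\mathbf{x}_v\rangle=-\frac{1}{\kappa-1}$ whenever $u,v$ are distinct vertices of $F$ with $uv\notin E(F)$. For a graph $H$ and positive integers $n,m$, $\lambda(n,H)$ is the maximum of $\vartheta(\bar G)$ over all $H$-free graphs $G$ with $n$ vertices, and $\mu(m,H)$ is the maximum of $\vartheta(\bar G)$ over all $H$-free graphs $G$ with $m$ edges. *)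

theory Defs
  imports Complex_Main "HOL-Library.Extended_Real"
begin

record 'a sgraph =
  gverts :: "'a set"
  gedges :: "'a set set"

definition simple_graph :: "'a sgraph \<Rightarrow> bool" where
  "simple_graph G \<longleftrightarrow>
     finite (gverts G) \<and> (\<forall>e \<in> gedges G. e \<subseteq> gverts G \<and> card e = 2)"

definition graph_complement :: "'a sgraph \<Rightarrow> 'a sgraph" where
  "graph_complement G =
     \<lparr>gverts = gverts G, gedges = {e. e \<subseteq> gverts G \<and> card e = 2 \<and> e \<notin> gedges G}\<rparr>"

definition delete_vertex :: "'a \<Rightarrow> 'a sgraph \<Rightarrow> 'a sgraph" where
  "delete_vertex v G = \<lparr>gverts = gverts G - {v}, gedges = {e \<in> gedges G. v \<notin> e}\<rparr>"

text \<open>A cycle is the list of its vertices, in cyclic order and without repetition.\<close>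

definition is_cycle :: "'a sgraph \<Rightarrow> 'a list \<Rightarrow> bool" where
  "is_cycle G p \<longleftrightarrow>
     3 \<le> length p \<and> distinct p \<and> set p \<subseteq> gverts G \<and>
     (\<forall>i < length p. {p ! i, p ! (Suc i mod length p)} \<in> gedges G)"

definition acyclic_graph :: "'a sgraph \<Rightarrow> bool" where
  "acyclic_graph G \<longleftrightarrow> (\<nexists>p. is_cycle G p)"

definition graph_isomorphic :: "'a sgraph \<Rightarrow> 'b sgraph \<Rightarrow> bool" where
  "graph_isomorphic G G' \<longleftrightarrow>
     (\<exists>f. bij_betw f (gverts G) (gverts G') \<and>
        (\<forall>u \<in> gverts G. \<forall>v \<in> gverts G. {u, v} \<in> gedges G \<longleftrightarrow> {f u, f v} \<in> gedges G'))"

definition is_subgraph :: "'a sgraph \<Rightarrow> 'a sgraph \<Rightarrow> bool" where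
  "is_subgraph S G \<longleftrightarrow>
     simple_graph S \<and> gverts S \<subseteq> gverts G \<and> gedges S \<subseteq> gedges G"

definition graph_free :: "'a sgraph \<Rightarrow> 'b sgraph \<Rightarrow> bool" where
  "graph_free H G \<longleftrightarrow> (\<nexists>S. is_subgraph S G \<and> graph_isomorphic H S)"

text \<open>The standard inner product on \<open>\<real>\<^sup>d\<close>; only the coordinates \<open>x 0, \<dots>, x (d - 1)\<close>
  of \<open>x\<close> matter. Since the dimension is existentially quantified below, it has to be a
  value rather than a type.\<close>

definition euclid_inner :: "nat \<Rightarrow> (nat \<Rightarrow> real) \<Rightarrow> (nat \<Rightarrow> real) \<Rightarrow> real" where
  "euclid_inner d x y = (\<Sum>i<d. x i * y i)"

definition theta_feasible :: "'a sgraph \<Rightarrow> real \<Rightarrow> bool" where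
  "theta_feasible F \<kappa> \<longleftrightarrow>
     2 \<le> \<kappa> \<and>
     (\<exists>(d :: nat) (x :: 'a \<Rightarrow> nat \<Rightarrow> real).
        (\<forall>v \<in> gverts F. sqrt (euclid_inner d (x v) (x v)) = 1) \<and>
        (\<forall>u \<in> gverts F. \<forall>v \<in> gverts F. u \<noteq> v \<and> {u, v} \<notin> gedges F \<longrightarrow>
           euclid_inner d (x u) (x v) = - (1 / (\<kappa> - 1))))"

text \<open>For a finite graph the feasible set is nonempty (the vertices of a regular simplex
  are feasible for \<open>\<kappa> = max 2 |V|\<close>), bounded below by 2, and closed (by compactness of the
  set of Gram matrices), so this infimum is the minimal feasible \<open>\<kappa>\<close>.\<close>

definition lovasz_theta :: "'a sgraph \<Rightarrow> real" where
  "lovasz_theta F = Inf {\<kappa>. theta_feasible F \<kappa>}"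

text \<open>The maxima \<open>\<lambda>(n, H)\<close> and \<open>\<mu>(m, H)\<close>. Every finite graph has an isomorphic copy with
  vertices in \<open>nat\<close>, and only finitely many values of theta occur (isolated vertices of \<open>G\<close>
  do not affect the theta function of its complement), so these suprema are maxima whenever
  some \<open>H\<close>-free graph of the given order or size exists. If there is none, as happens for
  instance when \<open>H\<close> has no edges and \<open>n\<close> is large, the value is \<open>- \<infinity>\<close>.\<close>

definition lambda_theta :: "nat \<Rightarrow> 'b sgraph \<Rightarrow> ereal" where
  "lambda_theta n H =
     Sup {ereal (lovasz_theta (graph_complement G)) | G :: nat sgraph.
            simple_graph G \<and> graph_free H G \<and> card (gverts G) = n}"

definition mu_theta :: "nat \<Rightarrow> 'b sgraph \<Rightarrow> ereal" where
  "mu_theta m H =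
     Sup {ereal (lovasz_theta (graph_complement G)) | G :: nat sgraph.
            simple_graph G \<and> graph_free H G \<and> card (gedges G) = m}"

end

theory Submission
  imports Defs "HOL-Analysis.Convex"
begin

text \<open>By semidefinite duality, if \<open>\<kappa>\<close> is infeasible for the complement of \<open>G\<close>, there are a positive
  semidefinite form \<open>N\<close> with diagonal at most 1, vanishing on the non-edges of \<open>G\<close>, and a unit
  vector \<open>w\<close> with \<open>w\<^sup>T N w \<ge> \<kappa>\<close>. In an \<open>H\<close>-free graph neighbourhoods contain no copy of the
  forest \<open>H - z\<close>, hence are degenerate, so closed neighbourhoods are \<open>K\<close>-colourable with
  \<open>K = |H| + 1\<close>. On a \<open>K\<close>-colourable set the form is at most \<open>K\<close> times the identity; therefore every
  row of \<open>N\<close> has squared norm at most \<open>K\<close>, and the trace of \<open>N\<^sup>3\<close> is at most \<open>n K\<^sup>2\<close>. This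
  gives \<open>(w\<^sup>T N w)\<^sup>3 \<le> n K\<^sup>2\<close>. If all degrees are at most \<open>D\<close>, the row bound alone gives
  \<open>w\<^sup>T N w = O(sqrt D)\<close>. For \<open>m\<close> edges, split the vertices at degree \<open>m\<^bsup>2/5\<^esup>\<close> and use the
  degree bound below and the cubic bound above this threshold.\<close>

section \<open>Positive semidefinite forms\<close>

definition qform :: "'a set \<Rightarrow> ('a \<Rightarrow> 'a \<Rightarrow> real) \<Rightarrow> ('a \<Rightarrow> real) \<Rightarrow> ('a \<Rightarrow> real) \<Rightarrow> real" where
  "qform V N x y = (\<Sum>u\<in>V. \<Sum>v\<in>V. N u v * x u * y v)"

text \<open>Over the reals, nonnegativity of the quadratic form does not force a symmetric kernel,
  so symmetry is demanded separately.\<close>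

definition psd :: "'a set \<Rightarrow> ('a \<Rightarrow> 'a \<Rightarrow> real) \<Rightarrow> bool" where
  "psd V N \<longleftrightarrow> (\<forall>u\<in>V. \<forall>v\<in>V. N u v = N v u) \<and> (\<forall>x. 0 \<le> qform V N x x)"

lemma qform_cong:
  assumes "\<And>u. u \<in> V \<Longrightarrow> x u = x' u" "\<And>u. u \<in> V \<Longrightarrow> y u = y' u"
  shows "qform V N x y = qform V N x' y'"
  unfolding qform_def using assms by (intro sum.cong) auto

lemma qform_add_left: "qform V N (\<lambda>u. x u + x' u) y = qform V N x y + qform V N x' y"
  by (simp add: qform_def algebra_simps sum.distrib)

lemma qform_add_right: "qform V N x (\<lambda>u. y u + y' u) = qform V N x y + qform V N x y'"
  by (simp add: qform_def algebra_simps sum.distrib)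

lemma qform_scale_left: "qform V N (\<lambda>u. a * x u) y = a * qform V N x y"
  by (simp add: qform_def sum_distrib_left mult_ac)

lemma qform_scale_right: "qform V N x (\<lambda>u. a * y u) = a * qform V N x y"
  by (simp add: qform_def sum_distrib_left mult_ac)

lemma qform_sum_left: "qform V N (\<lambda>u. \<Sum>c\<in>A. x c u) y = (\<Sum>c\<in>A. qform V N (x c) y)"
proof (cases "finite A")
  case True
  then show ?thesis
    by (induction A) (simp_all add: qform_add_left, simp add: qform_def)
qed (simp add: qform_def)

lemma qform_sum_right: "qform V N x (\<lambda>u. \<Sum>c\<in>A. y c u) = (\<Sum>c\<in>A. qform V N x (y c))"
proof (cases "finite A")
  case True
  then show ?thesis
    by (induction A) (simp_all add: qform_add_right, simp add: qform_def)
qed (simp add: qform_def)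

lemma qform_commute: "psd V N \<Longrightarrow> qform V N x y = qform V N y x"
  unfolding qform_def psd_def
  by (subst sum.swap) (auto intro!: sum.cong simp: mult_ac)

lemma psd_nonneg: "psd V N \<Longrightarrow> 0 \<le> qform V N x x"
  by (simp add: psd_def)

lemma psd_square_diff:
  assumes "psd V N"
  shows "0 \<le> a\<^sup>2 * qform V N x x - 2 * a * b * qform V N x y + b\<^sup>2 * qform V N y y"
proof -
  have "0 \<le> qform V N (\<lambda>u. a * x u + (- b) * y u) (\<lambda>u. a * x u + (- b) * y u)"
    using assms by (rule psd_nonneg)
  also have "\<dots> = a\<^sup>2 * qform V N x x - 2 * a * b * qform V N x y + b\<^sup>2 * qform V N y y"
    unfolding qform_add_left qform_add_right qform_scale_left qform_scale_right
      qform_commute[OF assms, of y x]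
    by (simp add: power2_eq_square algebra_simps)
  finally show ?thesis .
qed

lemma psd_Cauchy_Schwarz:
  assumes "psd V N"
  shows "(qform V N x y)\<^sup>2 \<le> qform V N x x * qform V N y y"
proof (cases "qform V N y y = 0")
  case True
  let ?q = "qform V N x y"
  have "?q = 0"
  proof (rule ccontr)
    assume "?q \<noteq> 0"
    \<comment> \<open>With this coefficient of \<open>y\<close> the expression equals
      \<open>-1\<close>: the \<open>y\<close>-square vanishes and the mixed term contributes
      \<open>-(qform V N x x + 1)\<close>.\<close>
    with psd_square_diff[OF assms, of 1 x "(qform V N x x + 1) / (2 * ?q)" y] True
    show False by simp
  qed
  with True show ?thesis by simp
next
  case False
  let ?q = "qform V N x y" and ?a = "qform V N x x" and ?b = "qform V N y y"
  have "?b > 0" using psd_nonneg[OF assms, of y] False by simp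
  have "0 \<le> ?b\<^sup>2 * ?a - 2 * ?b * ?q * ?q + ?q\<^sup>2 * ?b"
    using psd_square_diff[OF assms, of ?b x ?q y] .
  also have "\<dots> = ?b * (?a * ?b - ?q\<^sup>2)"
    by (simp add: power2_eq_square algebra_simps)
  finally show ?thesis using \<open>?b > 0\<close> by (simp add: zero_le_mult_iff)
qed

text \<open>Lagrange's form of Cauchy-Schwarz: the form is summed over all vectors
  \<open>a d * x c - a c * x d\<close>, and each summand is nonnegative. It serves twice, for adding
  up colour classes and for combining the rows of \<open>N\<close>.\<close>

lemma psd_combination_bound:
  assumes "psd V N"
  shows "qform V N (\<lambda>u. \<Sum>c\<in>A. a c * x c u) (\<lambda>u. \<Sum>c\<in>A. a c * x c u)
    \<le> (\<Sum>c\<in>A. (a c)\<^sup>2) * (\<Sum>c\<in>A. qform V N (x c) (x c))"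
proof -
  let ?q = "\<lambda>c d. qform V N (x c) (x d)"
  have "0 \<le> (\<Sum>c\<in>A. \<Sum>d\<in>A. (a d)\<^sup>2 * ?q c c - 2 * a d * a c * ?q c d + (a c)\<^sup>2 * ?q d d)"
    by (intro sum_nonneg psd_square_diff assms)
  also have "\<dots> = (\<Sum>c\<in>A. \<Sum>d\<in>A. (a d)\<^sup>2 * ?q c c) + (\<Sum>c\<in>A. \<Sum>d\<in>A. (a c)\<^sup>2 * ?q d d)
     - 2 * (\<Sum>c\<in>A. \<Sum>d\<in>A. a d * a c * ?q c d)"
    by (simp add: sum.distrib sum_subtractf sum_distrib_left mult_ac)
  also have "(\<Sum>c\<in>A. \<Sum>d\<in>A. (a d)\<^sup>2 * ?q c c) = (\<Sum>c\<in>A. (a c)\<^sup>2) * (\<Sum>c\<in>A. ?q c c)"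
    by (subst sum.swap) (simp add: sum_product)
  also have "(\<Sum>c\<in>A. \<Sum>d\<in>A. (a c)\<^sup>2 * ?q d d) = (\<Sum>c\<in>A. (a c)\<^sup>2) * (\<Sum>c\<in>A. ?q c c)"
    by (simp add: sum_product)
  also have "(\<Sum>c\<in>A. \<Sum>d\<in>A. a d * a c * ?q c d)
      = qform V N (\<lambda>u. \<Sum>c\<in>A. a c * x c u) (\<lambda>u. \<Sum>c\<in>A. a c * x c u)"
    unfolding qform_sum_left qform_sum_right qform_scale_left qform_scale_right
    by (simp add: sum_distrib_left mult_ac)
  finally show ?thesis by simp
qed

lemma psd_add_bound:
  assumes "psd V N"
  shows "qform V N (\<lambda>u. x u + y u) (\<lambda>u. x u + y u) \<le> 2 * qform V N x x + 2 * qform V N y y"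
  using psd_square_diff[OF assms, of 1 x 1 y] qform_commute[OF assms, of x y]
  by (simp add: qform_add_left qform_add_right)

lemma qform_unit_left:
  assumes "finite V" "u \<in> V"
  shows "qform V N (\<lambda>w. if w = u then 1 else 0) y = (\<Sum>v\<in>V. N u v * y v)"
proof -
  have "qform V N (\<lambda>w. if w = u then 1 else 0) y
      = (\<Sum>w\<in>V. if w = u then (\<Sum>v\<in>V. N u v * y v) else 0)"
    unfolding qform_def by (intro sum.cong) auto
  then show ?thesis using assms by simp
qed

text \<open>Extension by zero passes positivity to subsets and later allows a vector to be split
  along a partition of the vertices.\<close>

lemma qform_subset:
  assumes "finite V" "U \<subseteq> V"
  shows "qform U N x y = qform V N (\<lambda>u. if u \<in> U then x u else 0) (\<lambda>u. if u \<in> U then y u else 0)"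
proof -
  have "qform V N (\<lambda>u. if u \<in> U then x u else 0) (\<lambda>u. if u \<in> U then y u else 0)
     = (\<Sum>u\<in>V. if u \<in> U then (\<Sum>v\<in>V. if v \<in> U then N u v * x u * y v else 0) else 0)"
    unfolding qform_def by (intro sum.cong refl) (auto intro!: sum.cong)
  also have "\<dots> = qform U N x y"
    using assms by (simp add: qform_def sum.If_cases Int_absorb1 flip: sum.inter_restrict)
  finally show ?thesis ..
qed

lemma psd_subset:
  assumes "psd V N" "finite V" "U \<subseteq> V"
  shows "psd U N"
  using assms psd_nonneg[OF assms(1)] unfolding psd_def qform_subset[OF assms(2,3)]
  by blast

text \<open>The part of the closed neighbourhood of each vertex on which \<open>N\<close> lives splits into
  \<open>K\<close> classes that are independent with respect to the off-diagonal support of \<open>N\<close>.\<close>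

definition locally_colourable :: "nat \<Rightarrow> 'a set \<Rightarrow> ('a \<Rightarrow> 'a \<Rightarrow> real) \<Rightarrow> bool" where
  "locally_colourable K V N \<longleftrightarrow>
     (\<forall>u\<in>V. \<exists>col :: 'a \<Rightarrow> nat. \<forall>v\<in>V. N u v \<noteq> 0 \<longrightarrow> col v < K \<and>
        (\<forall>v'\<in>V. N u v' \<noteq> 0 \<longrightarrow> v \<noteq> v' \<longrightarrow> col v = col v' \<longrightarrow> N v v' = 0))"

section \<open>Bounds for forms with locally colourable support\<close>

lemma locally_colourable_subset:
  assumes "locally_colourable K V N" "U \<subseteq> V"
  shows "locally_colourable K U N"
  unfolding locally_colourable_def
proof
  fix u assume "u \<in> U"
  then have "u \<in> V" using assms(2) by blast
  with assms(1) obtain col :: "'a \<Rightarrow> nat" where "\<forall>v\<in>V. N u v \<noteq> 0 \<longrightarrow> col v < K \<and>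
      (\<forall>v'\<in>V. N u v' \<noteq> 0 \<longrightarrow> v \<noteq> v' \<longrightarrow> col v = col v' \<longrightarrow> N v v' = 0)"
    unfolding locally_colourable_def by blast
  then have "\<forall>v\<in>U. N u v \<noteq> 0 \<longrightarrow> col v < K \<and>
      (\<forall>v'\<in>U. N u v' \<noteq> 0 \<longrightarrow> v \<noteq> v' \<longrightarrow> col v = col v' \<longrightarrow> N v v' = 0)"
    using assms(2) by (simp add: subset_iff)
  then show "\<exists>col :: 'a \<Rightarrow> nat. \<forall>v\<in>U. N u v \<noteq> 0 \<longrightarrow> col v < K \<and>
      (\<forall>v'\<in>U. N u v' \<noteq> 0 \<longrightarrow> v \<noteq> v' \<longrightarrow> col v = col v' \<longrightarrow> N v v' = 0)" by (rule exI[of _ col])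
qed

text \<open>The row is cut into its colour classes. On one class \<open>N\<close> acts as a diagonal
  matrix with entries at most 1, so the form is at most the squared norm there; recombining
  \<open>K\<close> pieces costs a factor \<open>K\<close>.\<close>

lemma row_qform_bound:
  assumes "finite V" "psd V N" "\<And>v. v \<in> V \<Longrightarrow> N v v \<le> 1" "locally_colourable K V N" "u \<in> V"
  shows "qform V N (N u) (N u) \<le> K * (\<Sum>v\<in>V. (N u v)\<^sup>2)"
proof -
  obtain col :: "'a \<Rightarrow> nat" where
    lt: "\<And>v. v \<in> V \<Longrightarrow> N u v \<noteq> 0 \<Longrightarrow> col v < K" and
    ind: "\<And>v v'. v \<in> V \<Longrightarrow> v' \<in> V \<Longrightarrow> N u v \<noteq> 0 \<Longrightarrow> N u v' \<noteq> 0 \<Longrightarrow> v \<noteq> v' \<Longrightarrow>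
      col v = col v' \<Longrightarrow> N v v' = 0"
    using assms(4,5) unfolding locally_colourable_def by metis
  define f where "f c v = (if col v = c then N u v else 0)" for c v
  have split: "N u v = (\<Sum>c<K. f c v)" if "v \<in> V" for v
    using lt[OF that] by (cases "N u v = 0") (auto simp: f_def)
  have split2: "(\<Sum>c<K. (f c v)\<^sup>2) = (N u v)\<^sup>2" if "v \<in> V" for v
  proof -
    have "(\<Sum>c<K. (f c v)\<^sup>2) = (\<Sum>c<K. if col v = c then (N u v)\<^sup>2 else 0)"
      by (intro sum.cong) (auto simp: f_def)
    then show ?thesis using lt[OF that] by (cases "N u v = 0") auto
  qed
  have diag: "qform V N (f c) (f c) \<le> (\<Sum>v\<in>V. (f c v)\<^sup>2)" for c
  proof -
    have "N v v' * f c v * f c v' = (if v' = v then N v v * (f c v)\<^sup>2 else 0)"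
      if "v \<in> V" "v' \<in> V" for v v'
      using ind[of v v'] that by (cases "N u v = 0"; cases "N u v' = 0") (auto simp: f_def power2_eq_square)
    then have "qform V N (f c) (f c) = (\<Sum>v\<in>V. \<Sum>v'\<in>V. if v' = v then N v v * (f c v)\<^sup>2 else 0)"
      unfolding qform_def by (intro sum.cong refl) blast
    also have "\<dots> = (\<Sum>v\<in>V. N v v * (f c v)\<^sup>2)" using assms(1) by simp
    also have "\<dots> \<le> (\<Sum>v\<in>V. 1 * (f c v)\<^sup>2)"
      using assms(3) by (intro sum_mono mult_right_mono) auto
    also have "\<dots> = (\<Sum>v\<in>V. (f c v)\<^sup>2)" by simp
    finally show ?thesis .
  qed
  have "qform V N (N u) (N u) = qform V N (\<lambda>v. \<Sum>c<K. 1 * f c v) (\<lambda>v. \<Sum>c<K. 1 * f c v)"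
    by (intro qform_cong) (simp_all add: split)
  also have "\<dots> \<le> (\<Sum>c<K. 1\<^sup>2) * (\<Sum>c<K. qform V N (f c) (f c))"
    by (rule psd_combination_bound[OF assms(2)])
  also have "\<dots> \<le> K * (\<Sum>c<K. \<Sum>v\<in>V. (f c v)\<^sup>2)"
    by (auto intro!: mult_left_mono sum_mono diag)
  also have "(\<Sum>c<K. \<Sum>v\<in>V. (f c v)\<^sup>2) = (\<Sum>v\<in>V. (N u v)\<^sup>2)"
    by (subst sum.swap) (simp add: split2)
  finally show ?thesis .
qed

text \<open>Let \<open>s\<close> be the squared norm of the row. Pairing the row with the unit
  vector at \<open>u\<close> under \<open>N\<close> gives \<open>s\<close>, so Cauchy-Schwarz and
  the previous bound yield \<open>s\<^sup>2 \<le> N u u * K * s\<close>; then \<open>s\<close> is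
  cancelled.\<close>

lemma row_norm_bound:
  assumes "finite V" "psd V N" "\<And>v. v \<in> V \<Longrightarrow> N v v \<le> 1" "locally_colourable K V N" "u \<in> V"
  shows "(\<Sum>v\<in>V. (N u v)\<^sup>2) \<le> K"
proof (cases "(\<Sum>v\<in>V. (N u v)\<^sup>2) = 0")
  case False
  let ?s = "\<Sum>v\<in>V. (N u v)\<^sup>2" and ?e = "\<lambda>w. if w = u then 1 else (0::real)"
  have pos: "?s > 0" using False by (simp add: sum_nonneg order_less_le)
  have e: "qform V N ?e (N u) = ?s" "qform V N ?e ?e = N u u"
    using assms(1,5) by (simp_all add: qform_unit_left power2_eq_square if_distrib cong: if_cong)
  have "?s\<^sup>2 \<le> N u u * qform V N (N u) (N u)"
    using psd_Cauchy_Schwarz[OF assms(2), of ?e "N u"] unfolding e .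
  also have "\<dots> \<le> 1 * (K * ?s)"
    using assms by (intro mult_mono row_qform_bound psd_nonneg) auto
  finally show ?thesis using pos by (simp add: power2_eq_square)
qed simp

text \<open>Cauchy-Schwarz, once for the standard inner product and once for \<open>N\<close>,
  bounds the cube of the form at \<open>w\<close> by the form at \<open>N w\<close>. The vector
  \<open>N w\<close> combines the rows with weights \<open>w\<close>, so this is at most the sum of
  the row forms, which is the trace of the cube of \<open>N\<close>; each row form is at most
  \<open>K\<^sup>2\<close>.\<close>

lemma cubic_bound:
  assumes "finite V" "psd V N" "\<And>v. v \<in> V \<Longrightarrow> N v v \<le> 1" "locally_colourable K V N"
    and w: "(\<Sum>u\<in>V. (w u)\<^sup>2) \<le> 1"
  shows "(qform V N w w) ^ 3 \<le> card V * real K ^ 2"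
proof (cases "qform V N w w = 0")
  case False
  define l where "l = qform V N w w"
  have l: "l > 0" using psd_nonneg[OF assms(2), of w] False by (simp add: l_def)
  \<comment> \<open>\<open>r\<close> is the vector \<open>N w\<close> and \<open>R\<close> its
    squared norm, which is also the value of the form at the pair \<open>w\<close>,
    \<open>r\<close>.\<close>
  define r where "r v = (\<Sum>u\<in>V. w u * N u v)" for v
  define R where "R = (\<Sum>v\<in>V. (r v)\<^sup>2)"
  have wr: "qform V N w r = R"
    unfolding qform_def R_def
    by (subst sum.swap) (auto intro!: sum.cong simp: r_def power2_eq_square sum_distrib_right mult_ac)
  have lr: "l = (\<Sum>v\<in>V. w v * r v)"
    unfolding l_def qform_def
    by (subst sum.swap) (auto intro!: sum.cong simp: r_def sum_distrib_left mult_ac)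
  have "l\<^sup>2 \<le> (\<Sum>u\<in>V. (w u)\<^sup>2) * R"
    unfolding lr R_def by (rule Cauchy_Schwarz_ineq_sum)
  also have "\<dots> \<le> 1 * R" by (intro mult_right_mono w) (simp add: R_def sum_nonneg)
  finally have "l\<^sup>2 \<le> R" by simp
  then have "(l\<^sup>2)\<^sup>2 \<le> R\<^sup>2" by (intro power_mono) auto
  also have "\<dots> \<le> l * qform V N r r"
    using psd_Cauchy_Schwarz[OF assms(2), of w r] by (simp add: wr l_def)
  finally have "l * l ^ 3 \<le> l * qform V N r r" by (simp add: power2_eq_square power3_eq_cube mult_ac)
  then have "l ^ 3 \<le> qform V N r r" using l by simp
  also have "\<dots> \<le> (\<Sum>u\<in>V. (w u)\<^sup>2) * (\<Sum>u\<in>V. qform V N (N u) (N u))"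
    unfolding r_def by (rule psd_combination_bound[OF assms(2)])
  also have "\<dots> \<le> 1 * (\<Sum>u\<in>V. real K ^ 2)"
  proof (intro mult_mono w sum_mono sum_nonneg psd_nonneg assms)
    fix u assume u: "u \<in> V"
    have "qform V N (N u) (N u) \<le> K * (\<Sum>v\<in>V. (N u v)\<^sup>2)"
      by (rule row_qform_bound[OF assms(1-4) u])
    also have "\<dots> \<le> real K * real K"
      by (intro mult_left_mono row_norm_bound[OF assms(1-4) u]) auto
    finally show "qform V N (N u) (N u) \<le> real K ^ 2" by (simp add: power2_eq_square)
  qed auto
  finally show ?thesis by (simp add: l_def)
qed simp

text \<open>Schur's test: the form on unit vectors is at most the largest absolute row sum. A row
  with at most \<open>D\<close> nonzero entries and squared norm at most \<open>K\<close> has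
  absolute sum at most \<open>sqrt (D * K)\<close>.\<close>

lemma bounded_degree_bound:
  assumes "finite V" "psd V N" "\<And>v. v \<in> V \<Longrightarrow> N v v \<le> 1" "locally_colourable K V N"
    and deg: "\<And>u. u \<in> V \<Longrightarrow> real (card {v \<in> V. N u v \<noteq> 0}) \<le> D"
    and w: "(\<Sum>u\<in>V. (w u)\<^sup>2) \<le> 1" and "0 \<le> D"
  shows "qform V N w w \<le> sqrt (D * K)"
proof -
  have sym: "N u v = N v u" if "u \<in> V" "v \<in> V" for u v
    using assms(2) that by (auto simp: psd_def)
  have row: "(\<Sum>v\<in>V. \<bar>N u v\<bar>) \<le> sqrt (D * K)" if u: "u \<in> V" for u
  proof -
    let ?S = "{v \<in> V. N u v \<noteq> 0}"
    have "(\<Sum>v\<in>V. \<bar>N u v\<bar>) = (\<Sum>v\<in>?S. 1 * \<bar>N u v\<bar>)"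
      using assms(1) by (intro sum.mono_neutral_cong_right) auto
    also have "\<dots> \<le> sqrt ((\<Sum>v\<in>?S. 1\<^sup>2) * (\<Sum>v\<in>?S. \<bar>N u v\<bar>\<^sup>2))"
      by (intro real_le_rsqrt Cauchy_Schwarz_ineq_sum)
    also have "(\<Sum>v\<in>?S. \<bar>N u v\<bar>\<^sup>2) = (\<Sum>v\<in>V. (N u v)\<^sup>2)"
      using assms(1) by (intro sum.mono_neutral_cong_left) auto
    also have "sqrt ((\<Sum>v\<in>?S. 1\<^sup>2) * (\<Sum>v\<in>V. (N u v)\<^sup>2)) \<le> sqrt (D * K)"
      using deg[OF u] row_norm_bound[OF assms(1-4) u] assms
      by (intro real_sqrt_le_mono mult_mono) (auto intro: sum_nonneg)
    finally show ?thesis .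
  qed
  \<comment> \<open>The product of two entries of \<open>w\<close> is replaced by the mean of their
    squares; by symmetry of \<open>N\<close> both halves give the same sum.\<close>
  have "qform V N w w \<le> (\<Sum>u\<in>V. \<Sum>v\<in>V. \<bar>N u v\<bar> * (w u)\<^sup>2 / 2 + \<bar>N u v\<bar> * (w v)\<^sup>2 / 2)"
    unfolding qform_def
  proof (intro sum_mono)
    fix u v
    have "N u v * w u * w v \<le> \<bar>N u v\<bar> * \<bar>w u * w v\<bar>"
      by (metis abs_ge_self abs_mult mult.assoc)
    also have "\<dots> \<le> \<bar>N u v\<bar> * (((w u)\<^sup>2 + (w v)\<^sup>2) / 2)"
      using sum_squares_bound[of "\<bar>w u\<bar>" "\<bar>w v\<bar>"]
      by (intro mult_left_mono) (simp_all add: abs_mult)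
    finally have "N u v * w u * w v \<le> \<bar>N u v\<bar> * (((w u)\<^sup>2 + (w v)\<^sup>2) / 2)" .
    then show "N u v * w u * w v \<le> \<bar>N u v\<bar> * (w u)\<^sup>2 / 2 + \<bar>N u v\<bar> * (w v)\<^sup>2 / 2"
      by (simp add: distrib_left add_divide_distrib)
  qed
  also have "\<dots> = (\<Sum>u\<in>V. (w u)\<^sup>2 * (\<Sum>v\<in>V. \<bar>N u v\<bar>)) / 2 + (\<Sum>u\<in>V. \<Sum>v\<in>V. \<bar>N u v\<bar> * (w v)\<^sup>2) / 2"
    by (simp add: sum.distrib sum_divide_distrib sum_distrib_left mult_ac)
  also have "(\<Sum>u\<in>V. \<Sum>v\<in>V. \<bar>N u v\<bar> * (w v)\<^sup>2) = (\<Sum>u\<in>V. (w u)\<^sup>2 * (\<Sum>v\<in>V. \<bar>N u v\<bar>))"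
    by (subst sum.swap) (auto intro!: sum.cong simp: sum_distrib_left mult_ac sym)
  also have "(\<Sum>u\<in>V. (w u)\<^sup>2 * (\<Sum>v\<in>V. \<bar>N u v\<bar>)) \<le> (\<Sum>u\<in>V. (w u)\<^sup>2 * sqrt (D * K))"
    by (intro sum_mono mult_left_mono row) auto
  also have "\<dots> = (\<Sum>u\<in>V. (w u)\<^sup>2) * sqrt (D * K)" by (simp add: sum_distrib_right)
  also have "\<dots> \<le> 1 * sqrt (D * K)" using w assms by (intro mult_right_mono) auto
  finally show ?thesis by simp
qed

text \<open>\<open>Y\<close> is scaled on both sides by the inverse square roots of its diagonal.
  The vector \<open>w\<close> of these square roots has squared norm equal to the trace, and the
  form of \<open>N\<close> at \<open>w\<close> recovers the sum of all entries of
  \<open>Y\<close>.\<close>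

lemma psd_normalise:
  assumes "finite V" "psd V Y" "(\<Sum>v\<in>V. Y v v) = 1"
  obtains N w where "psd V N" "\<forall>v\<in>V. N v v \<le> 1" "(\<Sum>v\<in>V. (w v)\<^sup>2) = 1"
    "\<forall>u v. Y u v = 0 \<longrightarrow> N u v = 0" "(\<Sum>u\<in>V. \<Sum>v\<in>V. Y u v) = qform V N w w"
proof
  define w where "w v = sqrt (Y v v)" for v
  \<comment> \<open>Where \<open>w\<close> vanishes the division gives \<open>0\<close>, which is harmless since the whole row of \<open>Y\<close> is zero there.\<close>
  define N where "N u v = Y u v / (w u * w v)" for u v
  have diag: "qform V Y (\<lambda>w. if w = u then 1 else 0) (\<lambda>w. if w = v then 1 else 0) = Y u v"
    if "u \<in> V" "v \<in> V" for u v
    using assms(1) that by (simp add: qform_unit_left if_distrib cong: if_cong)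
  have nonneg: "0 \<le> Y v v" if "v \<in> V" for v
    using psd_nonneg[OF assms(2), of "\<lambda>w. if w = v then 1 else 0"] unfolding diag[OF that that] .
  \<comment> \<open>By the 2 by 2 minors, a zero diagonal entry forces its whole row and column to
    vanish.\<close>
  have zero: "Y u v = 0" if "u \<in> V" "v \<in> V" "w u = 0 \<or> w v = 0" for u v
  proof -
    have "(Y u v)\<^sup>2 \<le> Y u u * Y v v"
      using psd_Cauchy_Schwarz[OF assms(2), of "\<lambda>w. if w = u then 1 else 0" "\<lambda>w. if w = v then 1 else 0"]
      unfolding diag[OF that(1,2)] diag[OF that(1,1)] diag[OF that(2,2)] .
    then show ?thesis using that by (auto simp: w_def)
  qed
  show "psd V N"
    unfolding psd_def
  proof safe
    fix u v assume "u \<in> V" "v \<in> V"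
    then show "N u v = N v u" using assms(2) by (simp add: N_def psd_def mult_ac)
  next
    fix x
    have "qform V N x x = qform V Y (\<lambda>u. x u / w u) (\<lambda>u. x u / w u)"
      by (simp add: qform_def N_def field_simps)
    then show "0 \<le> qform V N x x" using psd_nonneg[OF assms(2)] by simp
  qed
  show "\<forall>v\<in>V. N v v \<le> 1"
    using nonneg by (simp add: N_def w_def)
  show "(\<Sum>v\<in>V. (w v)\<^sup>2) = 1"
    using nonneg assms(3) by (simp add: w_def)
  show "\<forall>u v. Y u v = 0 \<longrightarrow> N u v = 0"
    by (simp add: N_def)
  show "(\<Sum>u\<in>V. \<Sum>v\<in>V. Y u v) = qform V N w w"
    unfolding qform_def using zero
    by (intro sum.cong refl) (auto simp: N_def)
qed

section \<open>Semidefinite duality\<close>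

text \<open>Positive semidefiniteness witnessed by explicit vectors, as
  \<open>theta_feasible\<close> asks for; leaving the dimension free allows sums to be realised by
  concatenating coordinates.\<close>

definition gram :: "'a set \<Rightarrow> ('a \<Rightarrow> 'a \<Rightarrow> real) \<Rightarrow> bool" where
  "gram V P \<longleftrightarrow> (\<exists>d x. \<forall>u\<in>V. \<forall>v\<in>V. euclid_inner d (x u) (x v) = P u v)"

lemma sum_lessThan_add:
  fixes f :: "nat \<Rightarrow> 'a :: comm_monoid_add"
  shows "(\<Sum>i<m + n. f i) = (\<Sum>i<m. f i) + (\<Sum>i<n. f (m + i))"
  by (induction n) (simp_all add: add_ac)

lemma gram_add:
  assumes "gram V P" "gram V Q"
  shows "gram V (\<lambda>u v. P u v + Q u v)"
proof -
  obtain d x where x: "\<forall>u\<in>V. \<forall>v\<in>V. euclid_inner d (x u) (x v) = P u v"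
    using assms(1) unfolding gram_def by blast
  obtain d' x' where x': "\<forall>u\<in>V. \<forall>v\<in>V. euclid_inner d' (x' u) (x' v) = Q u v"
    using assms(2) unfolding gram_def by blast
  let ?y = "\<lambda>u i. if i < d then x u i else x' u (i - d)"
  have "euclid_inner (d + d') (?y u) (?y v) = euclid_inner d (x u) (x v) + euclid_inner d' (x' u) (x' v)" for u v
    by (simp add: euclid_inner_def sum_lessThan_add)
  then have "\<forall>u\<in>V. \<forall>v\<in>V. euclid_inner (d + d') (?y u) (?y v) = P u v + Q u v"
    using x x' by simp
  then show ?thesis unfolding gram_def by (intro exI[of _ "d + d'"] exI[of _ ?y])
qed

lemma gram_scale:
  assumes "gram V P" "0 \<le> c"
  shows "gram V (\<lambda>u v. c * P u v)"
proof -
  obtain d x where x: "\<forall>u\<in>V. \<forall>v\<in>V. euclid_inner d (x u) (x v) = P u v"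
    using assms(1) unfolding gram_def by blast
  have "euclid_inner d (\<lambda>i. sqrt c * x u i) (\<lambda>i. sqrt c * x v i) = c * euclid_inner d (x u) (x v)" for u v
    using assms(2) by (simp add: euclid_inner_def sum_distrib_left mult.left_commute mult.assoc
        flip: mult.assoc[of "sqrt c" "sqrt c"])
  then have "\<forall>u\<in>V. \<forall>v\<in>V. euclid_inner d (\<lambda>i. sqrt c * x u i) (\<lambda>i. sqrt c * x v i) = c * P u v"
    using x by simp
  then show ?thesis unfolding gram_def by (intro exI[of _ d] exI[of _ "\<lambda>u i. sqrt c * x u i"])
qed

lemma gram_rank_one: "gram V (\<lambda>u v. z u * z v)"
  unfolding gram_def
  by (intro exI[of _ 1] exI[of _ "\<lambda>u _. z u"]) (simp add: euclid_inner_def)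

lemma gram_zero: "gram V (\<lambda>u v. 0)"
  using gram_rank_one[of V "\<lambda>_. 0"] by simp

lemma gram_sum:
  "(\<And>a. a \<in> A \<Longrightarrow> gram V (P a)) \<Longrightarrow> gram V (\<lambda>u v. \<Sum>a\<in>A. P a u v)"
  by (induction A rule: infinite_finite_induct) (simp_all add: gram_zero gram_add)

section \<open>Separation of convex cones in finite dimension\<close>

text \<open>Functions vanishing outside \<open>I\<close> stand for the vectors indexed by
  \<open>I\<close>. The dominated functional is extended one coordinate at a time, starting from the
  zero space.\<close>

lemma finite_Hahn_Banach:
  fixes p :: "('i \<Rightarrow> real) \<Rightarrow> real"
  assumes "finite I"
    and add: "\<And>x y. p (\<lambda>i. x i + y i) \<le> p x + p y"
    and scale: "\<And>c x. 0 < c \<Longrightarrow> p (\<lambda>i. c * x i) = c * p x"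
  shows "\<exists>y. \<forall>x. (\<forall>i. i \<notin> I \<longrightarrow> x i = 0) \<longrightarrow> (\<Sum>i\<in>I. y i * x i) \<le> p x"
  using assms(1)
proof (induction I)
  case empty
  have "p (\<lambda>_. 0) = 0" using scale[of 2 "\<lambda>_. 0"] by simp
  moreover have "x = (\<lambda>_. 0)" if "\<forall>i. i \<notin> {} \<longrightarrow> x i = 0" for x :: "'i \<Rightarrow> real"
    using that by (intro ext) simp
  ultimately have "\<forall>x. (\<forall>i. i \<notin> {} \<longrightarrow> x i = 0) \<longrightarrow> (\<Sum>i\<in>{}. 0 * x i) \<le> p x"
    by (metis order_refl sum.empty)
  then show ?case by (rule exI[of _ "\<lambda>_. 0"])
next
  case (insert j I)
  obtain y where y: "\<And>x. \<forall>i. i \<notin> I \<longrightarrow> x i = 0 \<Longrightarrow> (\<Sum>i\<in>I. y i * x i) \<le> p x"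
    using insert.IH by blast
  define L where "L x = (\<Sum>i\<in>I. y i * x i)" for x
  define S where "S = {x :: 'i \<Rightarrow> real. \<forall>i. i \<notin> I \<longrightarrow> x i = 0}"
  have L: "L x \<le> p x" if "x \<in> S" for x using y that by (simp add: L_def S_def)
  have L_scale: "L (\<lambda>i. c * x i) = c * L x" for c x
    by (simp add: L_def sum_distrib_left mult_ac)
  \<comment> \<open>Each side constrains the coefficient of the new coordinate \<open>j\<close>;
    sublinearity makes every lower constraint compatible with every upper one, so the supremum
    \<open>a\<close> of the lower ones is admissible.\<close>
  have gap: "L x - p (x(j := -1)) \<le> p (x'(j := 1)) - L x'" if "x \<in> S" "x' \<in> S" for x x'
  proof -
    have "L x + L x' = L (\<lambda>i. x i + x' i)" by (simp add: L_def sum.distrib distrib_left)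
    also have "\<dots> \<le> p (\<lambda>i. x i + x' i)" using that by (intro L) (auto simp: S_def)
    also have "(\<lambda>i. x i + x' i) = (\<lambda>i. (x(j := -1)) i + (x'(j := 1)) i)"
      using that insert.hyps(2) by (auto simp: S_def)
    also have "p \<dots> \<le> p (x(j := -1)) + p (x'(j := 1))" by (rule add)
    finally show ?thesis by simp
  qed
  define a where "a = (SUP x\<in>S. L x - p (x(j := -1)))"
  have "(\<lambda>_. 0) \<in> S" by (simp add: S_def)
  then have ne: "S \<noteq> {}" by blast
  then have upper: "a \<le> p (x(j := 1)) - L x" if "x \<in> S" for x
    unfolding a_def using gap that by (intro cSUP_least) auto
  have lower: "L x - p (x(j := -1)) \<le> a" if "x \<in> S" for x
  proof -
    have "bdd_above ((\<lambda>x. L x - p (x(j := -1))) ` S)"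
      unfolding bdd_above_def using gap \<open>(\<lambda>_. 0) \<in> S\<close> by blast
    then show ?thesis unfolding a_def using that by (intro cSUP_upper)
  qed
  have "a * x j + L x \<le> p x" if x: "\<forall>i. i \<notin> insert j I \<longrightarrow> x i = 0" for x
  proof -
    \<comment> \<open>For nonzero \<open>x j\<close>, dividing by its absolute value reduces to
      coordinate 1 or -1 at \<open>j\<close>, where the constraints on \<open>a\<close>
      apply.\<close>
    define z where "z c = (\<lambda>i. c * (x(j := 0)) i)" for c :: real
    have zS: "z c \<in> S" for c using x by (auto simp: z_def S_def)
    have Lj: "L (x(j := 0)) = L x"
      unfolding L_def using insert.hyps(2) by (intro sum.cong) auto
    have Lz: "L (z c) = c * L x" for c unfolding z_def L_scale Lj ..
    consider "x j = 0" | "x j > 0" | "x j < 0" by linarith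
    then show ?thesis
    proof cases
      case 1
      then have "z 1 = x" by (auto simp: z_def)
      then show ?thesis using L[OF zS, of 1] 1 by simp
    next
      case 2
      let ?c = "1 / x j"
      have "p ((z ?c)(j := 1)) = p (\<lambda>i. ?c * x i)"
        using 2 by (intro arg_cong[where f = p]) (auto simp: z_def)
      also have "\<dots> = ?c * p x" using 2 by (intro scale) simp
      finally have "a \<le> ?c * p x - ?c * L x" using upper[OF zS, of ?c] by (simp add: Lz)
      then show ?thesis using 2 by (simp add: field_simps)
    next
      case 3
      let ?c = "1 / (- x j)"
      have "p ((z ?c)(j := -1)) = p (\<lambda>i. ?c * x i)"
        using 3 by (intro arg_cong[where f = p]) (auto simp: z_def)
      also have "\<dots> = ?c * p x" using 3 by (intro scale) simp
      finally have "?c * L x - ?c * p x \<le> a" using lower[OF zS, of ?c] by (simp add: Lz)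
      then show ?thesis using 3 by (simp add: field_simps)
    qed
  qed
  moreover have "(\<Sum>i\<in>insert j I. (y(j := a)) i * x i) = a * x j + L x" for x
  proof -
    have "(\<Sum>i\<in>I. (y(j := a)) i * x i) = L x"
      unfolding L_def using insert.hyps(2) by (intro sum.cong) auto
    then show ?thesis using insert.hyps by simp
  qed
  ultimately show ?case by (intro exI[of _ "y(j := a)"]) simp
qed

text \<open>The gauge \<open>p z\<close>, the infimum of all \<open>s\<close> with
  \<open>s * e - z\<close> in \<open>C\<close>, is sublinear. That \<open>e\<close> is an order unit
  makes the set of such \<open>s\<close> nonempty, and that \<open>- e\<close> lies outside
  \<open>C\<close> makes it bounded below. A linear functional below \<open>p\<close> is the
  separating one.\<close>

lemma cone_separation:
  fixes C :: "('i \<Rightarrow> real) set"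
  assumes "finite I"
    and add: "\<And>x y. x \<in> C \<Longrightarrow> y \<in> C \<Longrightarrow> (\<lambda>i. x i + y i) \<in> C"
    and scale: "\<And>c x. 0 \<le> c \<Longrightarrow> x \<in> C \<Longrightarrow> (\<lambda>i. c * x i) \<in> C"
    and cong: "\<And>x y. x \<in> C \<Longrightarrow> (\<And>i. i \<in> I \<Longrightarrow> x i = y i) \<Longrightarrow> y \<in> C"
    and unit: "\<And>z. \<exists>s. (\<lambda>i. s * e i + z i) \<in> C"
    and proper: "(\<lambda>i. - e i) \<notin> C"
  shows "\<exists>y. (\<Sum>i\<in>I. y i * e i) = 1 \<and> (\<forall>c\<in>C. 0 \<le> (\<Sum>i\<in>I. y i * c i))"
proof -
  define A where "A z = {s. (\<lambda>i. s * e i - z i) \<in> C}" for z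
  define p where "p z = Inf (A z)" for z
  have ne: "A z \<noteq> {}" for z
    using unit[of "\<lambda>i. - z i"] by (auto simp: A_def)
  have bdd: "bdd_below (A z)" for z
  proof -
    obtain t where t: "(\<lambda>i. t * e i + z i) \<in> C" using unit by blast
    \<comment> \<open>Otherwise the sum of the two members of \<open>C\<close> is a negative
      multiple of \<open>e\<close>, and rescaling puts \<open>- e\<close> into
      \<open>C\<close>.\<close>
    have "- t \<le> s" if "s \<in> A z" for s
    proof (rule ccontr)
      assume "\<not> - t \<le> s"
      then have neg: "s + t < 0" by simp
      have "(\<lambda>i. (s * e i - z i) + (t * e i + z i)) \<in> C"
        using add[of "\<lambda>i. s * e i - z i", OF _ t] that by (simp only: A_def mem_Collect_eq)
      then have "(\<lambda>i. (1 / - (s + t)) * ((s * e i - z i) + (t * e i + z i))) \<in> C"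
        using neg by (intro scale) auto
      moreover have "(1 / - (s + t)) * ((s * e i - z i) + (t * e i + z i)) = - e i" for i
        using neg by (simp add: field_simps)
      ultimately show False using proper by simp
    qed
    then show ?thesis unfolding bdd_below_def by blast
  qed
  have p_le: "p z \<le> s" if "s \<in> A z" for z s
    unfolding p_def using bdd that by (rule cInf_lower[rotated])
  have p_add: "p (\<lambda>i. x i + y i) \<le> p x + p y" for x y
  proof -
    have *: "p (\<lambda>i. x i + y i) \<le> s + t" if "s \<in> A x" "t \<in> A y" for s t
    proof (rule p_le)
      show "s + t \<in> A (\<lambda>i. x i + y i)"
        using add[of "\<lambda>i. s * e i - x i" "\<lambda>i. t * e i - y i"] that
        by (simp add: A_def algebra_simps)
    qed
    have "p (\<lambda>i. x i + y i) - t \<le> p x" if "t \<in> A y" for t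
      unfolding p_def[of x] using *[OF _ that] ne by (intro cInf_greatest) (auto simp: le_diff_eq diff_le_eq)
    then have "p (\<lambda>i. x i + y i) - p x \<le> p y"
      unfolding p_def[of y] using ne by (intro cInf_greatest) (auto simp: algebra_simps)
    then show ?thesis by simp
  qed
  have p_scale_le: "p (\<lambda>i. c * x i) \<le> c * p x" if "0 < c" for c x
  proof -
    have "p (\<lambda>i. c * x i) / c \<le> s" if s: "s \<in> A x" for s
    proof -
      have "c * s \<in> A (\<lambda>i. c * x i)"
        using scale[of c "\<lambda>i. s * e i - x i"] s \<open>0 < c\<close>
        by (simp add: A_def algebra_simps)
      from p_le[OF this] show ?thesis using \<open>0 < c\<close> by (simp add: field_simps)
    qed
    then have "p (\<lambda>i. c * x i) / c \<le> p x"
      unfolding p_def[of x] using ne by (intro cInf_greatest)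
    then show ?thesis using that by (simp add: field_simps)
  qed
  have p_scale: "p (\<lambda>i. c * x i) = c * p x" if "0 < c" for c x
  proof (rule antisym[OF p_scale_le[OF that]])
    have "p (\<lambda>i. (1 / c) * (c * x i)) \<le> (1 / c) * p (\<lambda>i. c * x i)"
      using that by (intro p_scale_le) simp
    then show "c * p x \<le> p (\<lambda>i. c * x i)" using that by (simp add: field_simps)
  qed
  obtain y where y: "\<And>x. \<forall>i. i \<notin> I \<longrightarrow> x i = 0 \<Longrightarrow> (\<Sum>i\<in>I. y i * x i) \<le> p x"
    using finite_Hahn_Banach[of I p, OF assms(1) p_add p_scale] by blast
  have y_le: "(\<Sum>i\<in>I. y i * x i) \<le> s" if "(\<lambda>i. s * e i - x i) \<in> C" for x s
  proof -
    let ?x = "\<lambda>i. if i \<in> I then x i else 0"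
    have "(\<Sum>i\<in>I. y i * x i) = (\<Sum>i\<in>I. y i * ?x i)" by (intro sum.cong) auto
    also have "\<dots> \<le> p ?x" by (rule y) simp
    also have "\<dots> \<le> s" using cong[OF that] by (intro p_le) (simp add: A_def)
    finally show ?thesis .
  qed
  obtain c0 where "c0 \<in> C" using unit by blast
  then have zero: "(\<lambda>_. 0) \<in> C" using scale[of 0 c0] by simp
  \<comment> \<open>Both bounds come from the zero vector of \<open>C\<close>, written as
    \<open>1 * e - e\<close> and as \<open>(-1) * e - (- e)\<close>.\<close>
  have "(\<Sum>i\<in>I. y i * e i) \<le> 1" using zero by (intro y_le) simp
  moreover have "(\<Sum>i\<in>I. y i * - e i) \<le> -1" using zero by (intro y_le) simp
  ultimately have "(\<Sum>i\<in>I. y i * e i) = 1" by (simp add: sum_negf)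
  moreover have "0 \<le> (\<Sum>i\<in>I. y i * c i)" if "c \<in> C" for c
  proof -
    have "(\<Sum>i\<in>I. y i * - c i) \<le> 0" using that by (intro y_le) simp
    then show ?thesis by (simp add: sum_negf)
  qed
  ultimately show ?thesis by blast
qed

text \<open>Kernels on ordered pairs whose symmetrisation agrees with a Gram matrix on the diagonal
  and on \<open>E\<close>. A functional that is nonnegative on this cone is automatically symmetric and
  vanishes off the diagonal and \<open>E\<close>.\<close>

definition edge_gram_cone :: "'a set \<Rightarrow> 'a set set \<Rightarrow> ('a \<times> 'a \<Rightarrow> real) set" where
  "edge_gram_cone V E = {z. \<exists>P. gram V P \<and>
     (\<forall>u\<in>V. \<forall>v\<in>V. u = v \<or> {u, v} \<in> E \<longrightarrow> z (u, v) + z (v, u) = 2 * P u v)}"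

lemma edge_gram_coneI:
  assumes "gram V P"
    "\<And>u v. u \<in> V \<Longrightarrow> v \<in> V \<Longrightarrow> u = v \<or> {u, v} \<in> E \<Longrightarrow> z (u, v) + z (v, u) = 2 * P u v"
  shows "z \<in> edge_gram_cone V E"
  using assms unfolding edge_gram_cone_def by blast

lemma edge_gram_cone_add:
  assumes "z \<in> edge_gram_cone V E" "z' \<in> edge_gram_cone V E"
  shows "(\<lambda>i. z i + z' i) \<in> edge_gram_cone V E"
proof -
  obtain P where P: "gram V P"
    "\<forall>u\<in>V. \<forall>v\<in>V. u = v \<or> {u, v} \<in> E \<longrightarrow> z (u, v) + z (v, u) = 2 * P u v"
    using assms(1) unfolding edge_gram_cone_def by blast
  obtain Q where Q: "gram V Q"
    "\<forall>u\<in>V. \<forall>v\<in>V. u = v \<or> {u, v} \<in> E \<longrightarrow> z' (u, v) + z' (v, u) = 2 * Q u v"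
    using assms(2) unfolding edge_gram_cone_def by blast
  have "(z (u, v) + z' (u, v)) + (z (v, u) + z' (v, u)) = 2 * (P u v + Q u v)"
    if "u \<in> V" "v \<in> V" "u = v \<or> {u, v} \<in> E" for u v
    using P(2)[rule_format, OF that] Q(2)[rule_format, OF that] by simp
  then show ?thesis by (intro edge_gram_coneI[OF gram_add[OF P(1) Q(1)]])
qed

lemma edge_gram_cone_scale:
  assumes "0 \<le> c" "z \<in> edge_gram_cone V E"
  shows "(\<lambda>i. c * z i) \<in> edge_gram_cone V E"
proof -
  obtain P where P: "gram V P"
    "\<forall>u\<in>V. \<forall>v\<in>V. u = v \<or> {u, v} \<in> E \<longrightarrow> z (u, v) + z (v, u) = 2 * P u v"
    using assms(2) unfolding edge_gram_cone_def by blast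
  have "c * z (u, v) + c * z (v, u) = 2 * (c * P u v)"
    if "u \<in> V" "v \<in> V" "u = v \<or> {u, v} \<in> E" for u v
    using P(2)[rule_format, OF that] by (metis distrib_left mult.left_commute)
  then show ?thesis by (intro edge_gram_coneI[OF gram_scale[OF P(1) assms(1)]])
qed

lemma edge_gram_cone_cong:
  assumes "z \<in> edge_gram_cone V E" "\<And>i. i \<in> V \<times> V \<Longrightarrow> z i = z' i"
  shows "z' \<in> edge_gram_cone V E"
proof -
  obtain P where P: "gram V P"
    "\<forall>u\<in>V. \<forall>v\<in>V. u = v \<or> {u, v} \<in> E \<longrightarrow> z (u, v) + z (v, u) = 2 * P u v"
    using assms(1) unfolding edge_gram_cone_def by blast
  have "z' (u, v) + z' (v, u) = 2 * P u v" if "u \<in> V" "v \<in> V" "u = v \<or> {u, v} \<in> E" for u v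
    using P(2)[rule_format, OF that] assms(2)[of "(u, v)"] assms(2)[of "(v, u)"] that by simp
  then show ?thesis by (intro edge_gram_coneI[OF P(1)])
qed

text \<open>Diagonal dominance: rank-one terms produce the off-diagonal entries of the symmetrised
  \<open>z\<close>, and a large multiple of the identity leaves room to correct the diagonal with
  nonnegative coefficients.\<close>

lemma edge_gram_cone_order_unit:
  fixes z :: "'a \<times> 'a \<Rightarrow> real"
  assumes "finite V"
  shows "\<exists>s\<ge>0. (\<lambda>i. s * (if fst i = snd i then 1 else 0) + z i) \<in> edge_gram_cone V E"
proof -
  define \<delta> where "\<delta> a u = (if u = a then 1 else 0 :: real)" for a u :: 'a
  \<comment> \<open>For distinct \<open>a\<close>, \<open>b\<close>, the square of this vector
    weighted by half of \<open>\<bar>z (a, b)\<bar>\<close> has off-diagonal entry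
    \<open>z (a, b) / 2\<close>; the sign is carried by \<open>sgn\<close>, so the weight stays
    nonnegative.\<close>
  define f where "f a b u = \<delta> a u + sgn (z (a, b)) * \<delta> b u" for a b u
  define Q where "Q u v = (\<Sum>(a, b)\<in>V \<times> V. \<bar>z (a, b)\<bar> / 2 * (f a b u * f a b v))" for u v
  \<comment> \<open>The sum dominates each single diagonal deviation, so all correction coefficients
    in \<open>P\<close> are nonnegative.\<close>
  define s where "s = (\<Sum>v\<in>V. \<bar>Q v v - z (v, v)\<bar>)"
  define P where "P u v = Q u v + (\<Sum>a\<in>V. (s + z (a, a) - Q a a) * (\<delta> a u * \<delta> a v))" for u v
  have le: "0 \<le> s + z (a, a) - Q a a" if "a \<in> V" for a
  proof -
    have "\<bar>Q a a - z (a, a)\<bar> \<le> s"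
      unfolding s_def using assms that by (intro member_le_sum) auto
    then show ?thesis by simp
  qed
  have "gram V Q"
    unfolding Q_def case_prod_unfold
    by (intro gram_sum gram_scale gram_rank_one) auto
  then have "gram V P"
    unfolding P_def by (intro gram_add gram_sum gram_scale gram_rank_one le)
  have off: "2 * P u v = z (u, v) + z (v, u)" if "u \<in> V" "v \<in> V" "u \<noteq> v" for u v
  proof -
    have zero: "\<delta> a u * \<delta> a v = 0" for a using that(3) by (auto simp: \<delta>_def)
    have "\<bar>z (a, b)\<bar> / 2 * (f a b u * f a b v)
        = (z (a, b) / 2) * (\<delta> a u * \<delta> b v) + (z (a, b) / 2) * (\<delta> a v * \<delta> b u)" for a b
    proof -
      have "\<bar>z (a, b)\<bar> * sgn (z (a, b)) = z (a, b)" by (simp add: abs_mult_sgn)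
      moreover have "f a b u * f a b v = \<delta> a u * \<delta> a v + sgn (z (a, b)) * (\<delta> a u * \<delta> b v)
         + sgn (z (a, b)) * (\<delta> a v * \<delta> b u) + (sgn (z (a, b)))\<^sup>2 * (\<delta> b u * \<delta> b v)"
        by (simp add: f_def algebra_simps power2_eq_square)
      ultimately show ?thesis by (simp add: zero algebra_simps)
    qed
    then have P: "P u v = (\<Sum>a\<in>V. \<Sum>b\<in>V. (z (a, b) / 2) * (\<delta> a u * \<delta> b v))
       + (\<Sum>a\<in>V. \<Sum>b\<in>V. (z (a, b) / 2) * (\<delta> a v * \<delta> b u))"
      unfolding P_def Q_def zero by (simp add: sum.distrib add_divide_distrib flip: sum.cartesian_product)
    have "(\<Sum>a\<in>V. \<Sum>b\<in>V. (z (a, b) / 2) * (\<delta> a x * \<delta> b y)) = z (x, y) / 2"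
      if "x \<in> V" "y \<in> V" for x y
    proof -
      have "(\<Sum>a\<in>V. \<Sum>b\<in>V. (z (a, b) / 2) * (\<delta> a x * \<delta> b y))
        = (\<Sum>a\<in>V. if x = a then (\<Sum>b\<in>V. if y = b then z (a, b) / 2 else 0) else 0)"
        by (intro sum.cong refl) (auto simp: \<delta>_def intro!: sum.cong)
      then show ?thesis using assms that by simp
    qed
    from this[OF that(1,2)] this[OF that(2,1)] show ?thesis unfolding P by simp
  qed
  have diag: "P v v = s + z (v, v)" if "v \<in> V" for v
  proof -
    have "(\<Sum>a\<in>V. (s + z (a, a) - Q a a) * (\<delta> a v * \<delta> a v))
        = (\<Sum>a\<in>V. if v = a then s + z (a, a) - Q a a else 0)"
      by (intro sum.cong) (auto simp: \<delta>_def)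
    then show ?thesis using assms that by (simp add: P_def)
  qed
  have "(\<lambda>i. s * (if fst i = snd i then 1 else 0) + z i) \<in> edge_gram_cone V E"
    using \<open>gram V P\<close>
  proof (rule edge_gram_coneI)
    fix u v assume "u \<in> V" "v \<in> V"
    then show "s * (if fst (u, v) = snd (u, v) then 1 else 0) + z (u, v)
       + (s * (if fst (v, u) = snd (v, u) then 1 else 0) + z (v, u)) = 2 * P u v"
      using off[of u v] diag[of v] by (cases "u = v") auto
  qed
  moreover have "0 \<le> s" by (simp add: s_def sum_nonneg)
  ultimately show ?thesis by blast
qed

section \<open>Infeasibility certificates for the theta function\<close>

text \<open>The kernel is \<open>\<kappa> - 1\<close> times the prescribed Gram matrix. Distinct
  nonadjacent vertices of the complement are exactly the edges of \<open>G\<close>, and the cone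
  leaves all other off-diagonal entries free.\<close>

lemma theta_feasible_complementI:
  assumes "simple_graph G" "2 \<le> \<kappa>"
    and cone: "(\<lambda>i. if fst i = snd i then \<kappa> - 1 else - 1) \<in> edge_gram_cone (gverts G) (gedges G)"
  shows "theta_feasible (graph_complement G) \<kappa>"
proof -
  let ?V = "gverts G"
  obtain P where P: "gram ?V P" and P': "\<forall>u\<in>?V. \<forall>v\<in>?V. u = v \<or> {u, v} \<in> gedges G \<longrightarrow>
      (if u = v then \<kappa> - 1 else - 1) + (if v = u then \<kappa> - 1 else - 1) = 2 * P u v"
    using cone unfolding edge_gram_cone_def mem_Collect_eq fst_conv snd_conv by blast
  obtain d x where x: "\<forall>u\<in>?V. \<forall>v\<in>?V. euclid_inner d (x u) (x v) = 1 / (\<kappa> - 1) * P u v"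
    using gram_scale[OF P, of "1 / (\<kappa> - 1)"] assms(2) unfolding gram_def by auto
  have "sqrt (euclid_inner d (x v) (x v)) = 1" if "v \<in> ?V" for v
    using x that P'[rule_format, of v v] assms(2) by simp
  moreover have "euclid_inner d (x u) (x v) = - (1 / (\<kappa> - 1))"
    if "u \<in> ?V" "v \<in> ?V" "u \<noteq> v" "{u, v} \<notin> gedges (graph_complement G)" for u v
  proof -
    have "{u, v} \<in> gedges G" using that by (auto simp: graph_complement_def)
    then show ?thesis using x that P'[rule_format, of u v] by simp
  qed
  ultimately show ?thesis
    unfolding theta_feasible_def using assms(2)
    by (auto simp: graph_complement_def intro!: exI[of _ d] exI[of _ x])
qed

text \<open>Infeasibility puts the target kernel \<open>b\<close> outside the cone. A functional
  nonnegative on the cone and nonpositive at \<open>b\<close> is the matrix \<open>Y\<close>: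
  rank-one kernels give positivity, the order unit \<open>e\<close> gives trace 1, and
  \<open>b\<close> gives the bound on the entry sum.\<close>

lemma theta_infeasible_certificate:
  assumes G: "simple_graph G" and "2 \<le> \<kappa>" and infeasible: "\<not> theta_feasible (graph_complement G) \<kappa>"
  obtains Y where "psd (gverts G) Y"
    "\<forall>u\<in>gverts G. \<forall>v\<in>gverts G. u \<noteq> v \<longrightarrow> {u, v} \<notin> gedges G \<longrightarrow> Y u v = 0"
    "(\<Sum>v\<in>gverts G. Y v v) = 1" "\<kappa> \<le> (\<Sum>u\<in>gverts G. \<Sum>v\<in>gverts G. Y u v)"
proof -
  let ?V = "gverts G" and ?K = "edge_gram_cone (gverts G) (gedges G)"
  have fin: "finite ?V" using G by (simp add: simple_graph_def)
  define e where "e i = (if fst i = snd i then 1 else 0 :: real)" for i :: "'a \<times> 'a"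
  define b where "b i = (if fst i = snd i then \<kappa> - 1 else - 1)" for i :: "'a \<times> 'a"
  have b: "b \<notin> ?K"
    using theta_feasible_complementI[OF G assms(2)] infeasible unfolding b_def by blast
  \<comment> \<open>Adding the ray through \<open>- b\<close> to the cone forces the separating
    functional to be nonpositive at \<open>b\<close>.\<close>
  define C where "C = {z. \<exists>c\<in>?K. \<exists>s\<ge>0. z = (\<lambda>i. c i - s * b i)}"
  have unit: "\<exists>s\<ge>0. (\<lambda>i. s * e i + z i) \<in> ?K" for z
    using edge_gram_cone_order_unit[OF fin] unfolding e_def .
  have CI: "(\<lambda>i. c i - s * b i) \<in> C" if "c \<in> ?K" "0 \<le> s" for c s
    unfolding C_def using that by blast
  have KC: "c \<in> C" if "c \<in> ?K" for c
    using CI[OF that, of 0] by simp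
  have zero: "(\<lambda>_. 0) \<in> ?K"
    by (rule edge_gram_coneI[OF gram_zero]) simp
  have "\<exists>y. (\<Sum>i\<in>?V \<times> ?V. y i * e i) = 1 \<and> (\<forall>c\<in>C. 0 \<le> (\<Sum>i\<in>?V \<times> ?V. y i * c i))"
  proof (rule cone_separation)
    show "finite (?V \<times> ?V)" using fin by simp
    fix x y assume "x \<in> C" "y \<in> C"
    then obtain c s d t where x: "c \<in> ?K" "s \<ge> 0" "x = (\<lambda>i. c i - s * b i)"
      and y: "d \<in> ?K" "t \<ge> 0" "y = (\<lambda>i. d i - t * b i)" unfolding C_def by blast
    have "(\<lambda>i. x i + y i) = (\<lambda>i. (c i + d i) - (s + t) * b i)"
      using x y by (auto simp: algebra_simps)
    moreover have "0 \<le> s + t" using x y by simp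
    ultimately show "(\<lambda>i. x i + y i) \<in> C"
      using CI[OF edge_gram_cone_add[OF x(1) y(1)]] by simp
  next
    fix a :: real and x assume a: "0 \<le> a" and "x \<in> C"
    then obtain c s where x: "c \<in> ?K" "s \<ge> 0" "x = (\<lambda>i. c i - s * b i)"
      unfolding C_def by blast
    have "(\<lambda>i. a * x i) = (\<lambda>i. a * c i - (a * s) * b i)"
      using x by (auto simp: algebra_simps)
    moreover have "0 \<le> a * s" using x a by simp
    ultimately show "(\<lambda>i. a * x i) \<in> C"
      using CI[OF edge_gram_cone_scale[OF a x(1)]] by simp
  next
    fix x y assume "x \<in> C" and xy: "\<And>i. i \<in> ?V \<times> ?V \<Longrightarrow> x i = y i"
    then obtain c s where x: "c \<in> ?K" "s \<ge> 0" "x = (\<lambda>i. c i - s * b i)"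
      unfolding C_def by blast
    have "(\<lambda>i. y i + s * b i) \<in> ?K"
      using x(1) by (rule edge_gram_cone_cong) (simp add: xy[symmetric] x(3))
    from CI[OF this x(2)] show "y \<in> C" by simp
  next
    show "\<exists>s. (\<lambda>i. s * e i + z i) \<in> C" for z using unit KC by blast
  next
    \<comment> \<open>If \<open>- e = c - s * b\<close>, then adding \<open>r * c\<close> to a cone
      member \<open>r * e + b\<close> gives \<open>(1 + r * s) * b\<close>, so \<open>b\<close>
      itself would lie in the cone.\<close>
    show "(\<lambda>i. - e i) \<notin> C"
    proof
      assume "(\<lambda>i. - e i) \<in> C"
      then obtain c s where c: "c \<in> ?K" "s \<ge> 0" "(\<lambda>i. - e i) = (\<lambda>i. c i - s * b i)"
        unfolding C_def by blast
      obtain r where r: "r \<ge> 0" "(\<lambda>i. r * e i + b i) \<in> ?K" using unit by blast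
      have "(\<lambda>i. (r * e i + b i) + r * c i) \<in> ?K"
        by (intro edge_gram_cone_add edge_gram_cone_scale r c)
      then have "(\<lambda>i. (1 / (1 + r * s)) * ((r * e i + b i) + r * c i)) \<in> ?K"
        using r c by (intro edge_gram_cone_scale) auto
      moreover have "(1 / (1 + r * s)) * ((r * e i + b i) + r * c i) = b i" for i
      proof -
        have ci: "c i = s * b i - e i" using fun_cong[OF c(3), of i] by simp
        have "0 \<le> r * s" using r c by simp
        then have "1 + r * s \<noteq> 0" by linarith
        moreover have "(r * e i + b i) + r * c i = (1 + r * s) * b i"
          unfolding ci by (simp add: algebra_simps)
        ultimately show ?thesis by simp
      qed
      ultimately show False using b by simp
    qed
  qed
  then obtain y where ye: "(\<Sum>i\<in>?V \<times> ?V. y i * e i) = 1"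
    and y: "\<And>c. c \<in> C \<Longrightarrow> 0 \<le> (\<Sum>i\<in>?V \<times> ?V. y i * c i)" by blast
  define Y where "Y u v = y (u, v)" for u v
  have unit_vec: "(\<Sum>i\<in>?V \<times> ?V. y i * (if i = j then 1 else 0)) = y j" if "j \<in> ?V \<times> ?V" for j
    using fin that by (simp add: if_distrib cong: if_cong)
  \<comment> \<open>Such a kernel and its negative both belong to the cone, with the zero Gram
    matrix as witness, so the functional vanishes on it.\<close>
  have orth: "(\<Sum>i\<in>?V \<times> ?V. y i * z i) = 0"
    if "\<And>u v. u = v \<or> {u, v} \<in> gedges G \<Longrightarrow> z (u, v) + z (v, u) = 0" for z
  proof -
    have "z \<in> ?K" by (rule edge_gram_coneI[OF gram_zero]) (use that in auto)
    then have "0 \<le> (\<Sum>i\<in>?V \<times> ?V. y i * z i)" by (intro y KC)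
    moreover have "(\<lambda>i. - z i) \<in> ?K"
    proof (rule edge_gram_coneI[OF gram_zero])
      fix u v assume "u = v \<or> {u, v} \<in> gedges G"
      then show "- z (u, v) + - z (v, u) = 2 * 0" using that[of u v] by simp
    qed
    then have "0 \<le> (\<Sum>i\<in>?V \<times> ?V. y i * - z i)" by (intro y KC)
    ultimately show ?thesis by (simp add: sum_negf)
  qed
  have sym: "Y u v = Y v u" if "u \<in> ?V" "v \<in> ?V" for u v
  proof -
    let ?z = "\<lambda>i. (if i = (u, v) then 1 else 0) - (if i = (v, u) then 1 else 0 :: real)"
    have "(\<Sum>i\<in>?V \<times> ?V. y i * ?z i) = 0"
      by (rule orth[where z = ?z]) (simp add: conj_commute)
    then show ?thesis
      using that unit_vec[of "(u, v)"] unit_vec[of "(v, u)"]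
      by (simp add: Y_def right_diff_distrib sum_subtractf)
  qed
  have off: "Y u v = 0" if "u \<in> ?V" "v \<in> ?V" "u \<noteq> v" "{u, v} \<notin> gedges G" for u v
  proof -
    have "(\<Sum>i\<in>?V \<times> ?V. y i * (if i = (u, v) then 1 else 0)) = 0"
    proof (rule orth)
      fix a b assume ab: "a = b \<or> {a, b} \<in> gedges G"
      have "(a, b) \<noteq> (u, v)" "(b, a) \<noteq> (u, v)" using ab that by (auto simp: insert_commute)
      then show "(if (a, b) = (u, v) then 1 else 0) + (if (b, a) = (u, v) then 1 else 0) = (0::real)"
        by (simp only: if_False add_0)
    qed
    then show ?thesis using that unit_vec[of "(u, v)"] by (simp add: Y_def)
  qed
  have "psd ?V Y"
    unfolding psd_def
  proof (intro conjI ballI allI)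
    fix x
    have "(\<lambda>i. x (fst i) * x (snd i)) \<in> ?K"
      by (rule edge_gram_coneI[OF gram_rank_one[of _ x]]) simp
    then have "0 \<le> (\<Sum>i\<in>?V \<times> ?V. y i * (x (fst i) * x (snd i)))" by (intro y KC)
    also have "\<dots> = qform ?V Y x x"
      by (simp add: qform_def Y_def sum.cartesian_product case_prod_unfold mult_ac)
    finally show "0 \<le> qform ?V Y x x" .
  qed (rule sym)
  moreover have tr: "(\<Sum>v\<in>?V. Y v v) = 1"
  proof -
    have "(\<Sum>i\<in>?V \<times> ?V. y i * e i) = (\<Sum>u\<in>?V. \<Sum>v\<in>?V. if v = u then Y u u else 0)"
      by (auto simp: sum.cartesian_product e_def Y_def intro!: sum.cong)
    then show ?thesis using ye fin by simp
  qed
  moreover have "\<kappa> \<le> (\<Sum>u\<in>?V. \<Sum>v\<in>?V. Y u v)"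
  proof -
    \<comment> \<open>Since \<open>- b\<close> is the all-ones kernel minus
      \<open>\<kappa> * e\<close>, nonnegativity here compares the sum of all entries with
      \<open>\<kappa>\<close> times the trace.\<close>
    have "(\<lambda>i. 0 - 1 * b i) \<in> C" by (rule CI[OF zero]) simp
    then have "0 \<le> (\<Sum>i\<in>?V \<times> ?V. y i * (0 - 1 * b i))" by (rule y)
    also have "\<dots> = (\<Sum>i\<in>?V \<times> ?V. y i - \<kappa> * (y i * e i))"
      by (intro sum.cong) (auto simp: b_def e_def algebra_simps)
    also have "\<dots> = (\<Sum>i\<in>?V \<times> ?V. y i) - \<kappa>"
      unfolding sum_subtractf sum_distrib_left[symmetric] ye by simp
    also have "(\<Sum>i\<in>?V \<times> ?V. y i) = (\<Sum>u\<in>?V. \<Sum>v\<in>?V. Y u v)"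
      by (simp add: sum.cartesian_product Y_def)
    finally show ?thesis by simp
  qed
  ultimately show thesis using that off by blast
qed

section \<open>Forests and neighbourhood colourings\<close>

lemma path_prefix_cycle:
  assumes "simple_graph G" "distinct p" "set p \<subseteq> gverts G"
    and path: "\<And>i. Suc i < length p \<Longrightarrow> {p ! i, p ! Suc i} \<in> gedges G"
    and j: "2 \<le> j" "j < length p" "{p ! j, p ! 0} \<in> gedges G"
  shows "is_cycle G (take (Suc j) p)"
  unfolding is_cycle_def
proof (intro conjI allI impI)
  show "set (take (Suc j) p) \<subseteq> gverts G" using assms(3) set_take_subset by fast
  fix i assume "i < length (take (Suc j) p)"
  then have i: "i \<le> j" using j by simp
  show "{take (Suc j) p ! i, take (Suc j) p ! (Suc i mod length (take (Suc j) p))} \<in> gedges G"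
  proof (cases "i = j")
    case False
    then have "Suc i < Suc j" using i by simp
    then show ?thesis using path[of i] j by simp
  qed (use j in simp)
qed (use assms in auto)

text \<open>The first vertex of a longest path works: a neighbour off the path would extend it, and
  one at index 2 or later would close a cycle. Isolated vertices are allowed.\<close>

lemma acyclic_graph_has_leaf:
  assumes "simple_graph F" "acyclic_graph F" "gverts F \<noteq> {}"
  obtains x where "x \<in> gverts F" "\<And>y z. {x, y} \<in> gedges F \<Longrightarrow> {x, z} \<in> gedges F \<Longrightarrow> y = z"
proof -
  define path where "path p \<longleftrightarrow> p \<noteq> [] \<and> distinct p \<and> set p \<subseteq> gverts F \<and>
    (\<forall>i. Suc i < length p \<longrightarrow> {p ! i, p ! Suc i} \<in> gedges F)" for p
  have fin: "finite (gverts F)" using assms(1) by (simp add: simple_graph_def)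
  obtain a where "a \<in> gverts F" using assms(3) by blast
  then have "path [a]" by (simp add: path_def)
  moreover have "\<forall>p. path p \<longrightarrow> length p < Suc (card (gverts F))"
    using fin by (metis path_def card_mono distinct_card le_imp_less_Suc)
  ultimately obtain p where p: "path p" and max: "\<And>q. path q \<Longrightarrow> length q \<le> length p"
    using ex_has_greatest_nat[of path "[a]" length "Suc (card (gverts F))"] by blast
  then have ne: "p \<noteq> []" by (simp add: path_def)
  have edge: "y \<in> gverts F \<and> y \<noteq> p ! 0" if "{p ! 0, y} \<in> gedges F" for y
    using that assms(1) by (fastforce simp: simple_graph_def)
  have second: "1 < length p \<and> y = p ! 1" if y: "{p ! 0, y} \<in> gedges F" for y
  proof -
    have "y \<in> set p"
    proof (rule ccontr)
      assume "y \<notin> set p"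
      then have "path (y # p)"
        using p edge[OF y] y
        by (auto simp: path_def nth_Cons insert_commute split: nat.splits)
      then show False using max by fastforce
    qed
    then obtain j where j: "j < length p" "y = p ! j" by (metis in_set_conv_nth)
    have "j \<noteq> 0" using edge[OF y] j by (metis)
    moreover have "\<not> 2 \<le> j"
    proof
      assume "2 \<le> j"
      then have "is_cycle F (take (Suc j) p)"
        using p j y assms(1) by (intro path_prefix_cycle) (auto simp: path_def insert_commute)
      then show False using assms(2) by (auto simp: acyclic_graph_def)
    qed
    ultimately have "j = 1" by simp
    then show ?thesis using j by simp
  qed
  show thesis
  proof
    show "p ! 0 \<in> gverts F" using p ne by (auto simp: path_def)
    show "y = z" if "{p ! 0, y} \<in> gedges F" "{p ! 0, z} \<in> gedges F" for y z
      using second that by metis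
  qed
qed

lemma simple_delete_vertex: "simple_graph G \<Longrightarrow> simple_graph (delete_vertex v G)"
  by (auto simp: simple_graph_def delete_vertex_def)

lemma acyclic_delete_vertex: "acyclic_graph G \<Longrightarrow> acyclic_graph (delete_vertex v G)"
  by (force simp: acyclic_graph_def delete_vertex_def is_cycle_def)

text \<open>A leaf or isolated vertex \<open>x\<close> is removed and the rest embedded by
  induction. Fewer than \<open>h\<close> vertices are then occupied, so the image of the neighbour
  of \<open>x\<close> still has a free neighbour in \<open>U\<close>.\<close>

lemma forest_embedding:
  assumes "simple_graph F" "acyclic_graph F" "card (gverts F) \<le> h"
    and "finite U" "U \<noteq> {}"
    and deg: "\<And>u. u \<in> U \<Longrightarrow> h \<le> card {w \<in> U. adj u w}"
    and sym: "\<And>u v. adj u v \<Longrightarrow> adj v u"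
  shows "\<exists>f. inj_on f (gverts F) \<and> f ` gverts F \<subseteq> U \<and>
    (\<forall>x\<in>gverts F. \<forall>y\<in>gverts F. {x, y} \<in> gedges F \<longrightarrow> adj (f x) (f y))"
  using assms(1-3)
proof (induction "card (gverts F)" arbitrary: F)
  case 0
  then show ?case by (auto simp: simple_graph_def)
next
  case (Suc n)
  have fin: "finite (gverts F)" using Suc.prems by (simp add: simple_graph_def)
  have "gverts F \<noteq> {}" using Suc.hyps(2) by auto
  then obtain x where x: "x \<in> gverts F"
    and leaf: "\<And>y z. {x, y} \<in> gedges F \<Longrightarrow> {x, z} \<in> gedges F \<Longrightarrow> y = z"
    using acyclic_graph_has_leaf Suc.prems(1,2) by metis
  let ?F = "delete_vertex x F"
  have V: "gverts ?F = gverts F - {x}" by (simp add: delete_vertex_def)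
  have card: "card (gverts ?F) = n" using Suc.hyps(2) x fin by (simp add: V)
  obtain f where f: "inj_on f (gverts ?F)" "f ` gverts ?F \<subseteq> U"
    "\<And>y z. y \<in> gverts ?F \<Longrightarrow> z \<in> gverts ?F \<Longrightarrow> {y, z} \<in> gedges ?F \<Longrightarrow> adj (f y) (f z)"
    using Suc.hyps(1)[OF card[symmetric] simple_delete_vertex[OF Suc.prems(1)]
        acyclic_delete_vertex[OF Suc.prems(2)]] Suc.prems(3) card Suc.hyps(2) by auto
  have img: "card (f ` gverts ?F) < h" "finite (f ` gverts ?F)"
    using card_image_le[of "gverts ?F" f] card Suc.hyps(2) Suc.prems(3) fin by (auto simp: V)
  have fresh: "\<exists>b \<in> {w \<in> U. adj a w}. b \<notin> f ` gverts ?F" if "a \<in> U" for a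
    using deg[OF that] img card_mono[of "f ` gverts ?F" "{w \<in> U. adj a w}"]
    by (meson leD order_trans subsetI le_less_trans)
  obtain b where b: "b \<in> U" "b \<notin> f ` gverts ?F"
    and nb: "\<And>y. {x, y} \<in> gedges F \<Longrightarrow> adj (f y) b"
  proof (cases "\<exists>y. {x, y} \<in> gedges F")
    case True
    then obtain y where y: "{x, y} \<in> gedges F" by blast
    then have "y \<in> gverts ?F" using Suc.prems(1) by (fastforce simp: V simple_graph_def)
    then have "f y \<in> U" using f(2) by blast
    then obtain b where "b \<in> U" "adj (f y) b" "b \<notin> f ` gverts ?F" using fresh by blast
    then show thesis using that leaf y by metis
  next
    case False
    then show thesis using that fresh assms(5) by blast
  qed
  let ?g = "f(x := b)"
  have ins: "gverts F = insert x (gverts ?F)" using x by (auto simp: V)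
  have "inj_on ?g (gverts F)" unfolding ins
    using f(1) b(2) by (auto simp: V inj_on_def image_iff)
  moreover have "?g ` gverts F \<subseteq> U" unfolding ins
    using f(2) b(1) by (auto simp: V)
  moreover have "adj (?g y) (?g z)" if yz: "y \<in> gverts F" "z \<in> gverts F" "{y, z} \<in> gedges F" for y z
  proof -
    have ne: "y \<noteq> z" using yz(3) Suc.prems(1) by (auto simp: simple_graph_def)
    consider "y = x" | "z = x" | "y \<noteq> x" "z \<noteq> x" by blast
    then show ?thesis
    proof cases
      case 1 then show ?thesis using ne nb[of z] sym yz by auto
    next
      case 2 then show ?thesis using ne nb[of y] yz by (auto simp: insert_commute)
    next
      case 3 then show ?thesis using f(3)[of y z] yz by (auto simp: delete_vertex_def)
    qed
  qed
  ultimately show ?case by blast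
qed

section \<open>Colourings of neighbourhoods in H-free graphs\<close>

text \<open>Greedy colouring: a vertex with fewer than \<open>h\<close> neighbours is coloured last,
  when some colour is still missing around it.\<close>

lemma degenerate_colouring:
  assumes "finite U" and sym: "\<And>u v. adj u v \<Longrightarrow> adj v u"
    and "\<And>W. W \<subseteq> U \<Longrightarrow> W \<noteq> {} \<Longrightarrow> \<exists>u\<in>W. card {w \<in> W. adj u w} < h"
  shows "\<exists>col :: 'a \<Rightarrow> nat. (\<forall>u\<in>U. col u < h) \<and> (\<forall>u\<in>U. \<forall>v\<in>U. u \<noteq> v \<longrightarrow> adj u v \<longrightarrow> col u \<noteq> col v)"
  using assms(1,3)
proof (induction "card U" arbitrary: U)
  case 0
  then show ?case by auto
next
  case (Suc n)
  have "U \<noteq> {}" using Suc.hyps(2) by auto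
  then obtain u where u: "u \<in> U" "card {w \<in> U. adj u w} < h" using Suc.prems(2) by blast
  have "card (U - {u}) = n" using Suc.hyps(2) u Suc.prems(1) by simp
  moreover have "\<exists>a\<in>W. card {w \<in> W. adj a w} < h" if "W \<subseteq> U - {u}" "W \<noteq> {}" for W
    using that Suc.prems(2)[of W] by blast
  ultimately obtain col :: "'a \<Rightarrow> nat" where col: "\<forall>v\<in>U - {u}. col v < h"
    "\<forall>v\<in>U - {u}. \<forall>w\<in>U - {u}. v \<noteq> w \<longrightarrow> adj v w \<longrightarrow> col v \<noteq> col w"
    using Suc.hyps(1)[of "U - {u}"] Suc.prems(1) by (auto simp del: insert_iff)
  let ?A = "{w \<in> U. adj u w}"
  have "card (col ` ?A) < card {..<h}"
    using card_image_le[of ?A col] u(2) Suc.prems(1) by simp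
  then have "\<not> {..<h} \<subseteq> col ` ?A"
    using card_mono[of "col ` ?A" "{..<h}"] Suc.prems(1) by (auto simp: not_le simp del: card_lessThan)
  then obtain c where c: "c < h" "c \<notin> col ` ?A" by blast
  have "(\<forall>v\<in>U. (col(u := c)) v < h) \<and>
     (\<forall>v\<in>U. \<forall>w\<in>U. v \<noteq> w \<longrightarrow> adj v w \<longrightarrow> (col(u := c)) v \<noteq> (col(u := c)) w)"
    using col c sym by (auto simp: image_iff dest: sym)
  then show ?case by blast
qed

text \<open>The subgraph consists of exactly the image edges; injectivity then lets \<open>f\<close>
  reflect edges as well, which \<open>graph_isomorphic\<close> demands.\<close>

lemma embedding_imp_not_free:
  assumes "simple_graph H" "simple_graph G" "inj_on f (gverts H)" "f ` gverts H \<subseteq> gverts G"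
    and edge: "\<And>x y. x \<in> gverts H \<Longrightarrow> y \<in> gverts H \<Longrightarrow> {x, y} \<in> gedges H \<Longrightarrow> {f x, f y} \<in> gedges G"
  shows "\<not> graph_free H G"
proof -
  define S where "S = \<lparr>gverts = f ` gverts H, gedges = (\<lambda>e. f ` e) ` gedges H\<rparr>"
  have edges: "e \<subseteq> gverts H \<and> card e = 2" if "e \<in> gedges H" for e
    using assms(1) that by (auto simp: simple_graph_def)
  have "f ` e \<in> gedges G" if "e \<in> gedges H" for e
  proof -
    have "card e = 2" using edges that by blast
    then obtain x y where "e = {x, y}" by (meson card_2_iff)
    then show ?thesis using edge[of x y] edges[OF that] that by auto
  qed
  moreover have "card (f ` e) = 2" if "e \<in> gedges H" for e
    using edges[OF that] card_image[of f e] inj_on_subset[OF assms(3)] by auto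
  ultimately have "is_subgraph S G"
    using assms(1,4) image_mono[of _ "gverts H" f] edges unfolding is_subgraph_def S_def
    by (auto simp: simple_graph_def subset_iff)
  moreover have "graph_isomorphic H S"
    unfolding graph_isomorphic_def
  proof (intro exI conjI ballI)
    show "bij_betw f (gverts H) (gverts S)" using assms(3) by (simp add: S_def bij_betw_def)
    fix u v assume uv: "u \<in> gverts H" "v \<in> gverts H"
    have "e = {u, v}" if "e \<in> gedges H" "f ` e = f ` {u, v}" for e
      using inj_on_image_eq_iff[OF assms(3), of e "{u, v}"] edges[OF that(1)] that(2) uv by auto
    then have "{u, v} \<in> gedges H \<longleftrightarrow> f ` {u, v} \<in> (`) f ` gedges H"
      by (metis (no_types, lifting) image_iff)
    then show "({u, v} \<in> gedges H) = ({f u, f v} \<in> gedges S)"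
      by (simp add: S_def)
  qed
  ultimately show ?thesis by (auto simp: graph_free_def)
qed

text \<open>A subset of the neighbourhood with minimum degree at least
  \<open>card (gverts H)\<close> would contain the forest \<open>H - z\<close>, and mapping
  \<open>z\<close> to \<open>u\<close> would complete a copy of \<open>H\<close>. Hence the
  neighbourhood is degenerate.\<close>

lemma neighbourhood_colouring:
  assumes "simple_graph H" "z \<in> gverts H" "acyclic_graph (delete_vertex z H)"
    and "simple_graph G" "graph_free H G" "u \<in> gverts G"
  shows "\<exists>col :: 'a \<Rightarrow> nat. (\<forall>v. {u, v} \<in> gedges G \<longrightarrow> col v < card (gverts H)) \<and>
    (\<forall>v w. {u, v} \<in> gedges G \<longrightarrow> {u, w} \<in> gedges G \<longrightarrow> v \<noteq> w \<longrightarrow> {v, w} \<in> gedges G \<longrightarrow> col v \<noteq> col w)"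
proof -
  let ?U = "{v. {u, v} \<in> gedges G}" and ?h = "card (gverts H)" and ?F = "delete_vertex z H"
  define adj where "adj a b \<longleftrightarrow> {a, b} \<in> gedges G" for a b
  have irrefl: "\<not> adj a a" for a
    using assms(4) by (auto simp: adj_def simple_graph_def)
  have sym: "adj b a" if "adj a b" for a b
    using that by (simp add: adj_def insert_commute)
  have sub: "?U \<subseteq> gverts G" using assms(4) by (auto simp: simple_graph_def)
  then have fin: "finite ?U" using assms(4) by (auto simp: simple_graph_def intro: finite_subset)
  have "\<exists>a\<in>W. card {w \<in> W. adj a w} < ?h" if W: "W \<subseteq> ?U" "W \<noteq> {}" for W
  proof (rule ccontr)
    assume "\<not> ?thesis"
    then have deg: "?h \<le> card {w \<in> W. adj a w}" if "a \<in> W" for a using that by fastforce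
    have VF: "gverts ?F = gverts H - {z}" by (simp add: delete_vertex_def)
    have finH: "finite (gverts H)" using assms(1) by (simp add: simple_graph_def)
    have "card (gverts ?F) \<le> ?h" unfolding VF using finH by (auto intro: card_mono)
    then have "\<exists>f. inj_on f (gverts ?F) \<and> f ` gverts ?F \<subseteq> W \<and>
        (\<forall>x\<in>gverts ?F. \<forall>y\<in>gverts ?F. {x, y} \<in> gedges ?F \<longrightarrow> adj (f x) (f y))"
      using forest_embedding[where h = ?h and adj = adj, OF simple_delete_vertex[OF assms(1)] assms(3) _
        finite_subset[OF W(1) fin] W(2) deg sym] by simp
    then obtain f where f0: "inj_on f (gverts ?F) \<and> f ` gverts ?F \<subseteq> W \<and>
        (\<forall>x\<in>gverts ?F. \<forall>y\<in>gverts ?F. {x, y} \<in> gedges ?F \<longrightarrow> adj (f x) (f y))" ..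
    then have f: "inj_on f (gverts ?F)" "f ` gverts ?F \<subseteq> W"
      "\<And>x y. x \<in> gverts ?F \<Longrightarrow> y \<in> gverts ?F \<Longrightarrow> {x, y} \<in> gedges ?F \<Longrightarrow> adj (f x) (f y)"
      by simp_all
    define g where "g = f(z := u)"
    have nuW: "u \<notin> W" using W(1) irrefl by (auto simp: adj_def)
    have gf: "g x = f x" "f x \<in> W" if "x \<in> gverts H" "x \<noteq> z" for x
      using f(2) that by (auto simp: g_def VF)
    have adju: "adj u a" if "a \<in> W" for a using W(1) that by (auto simp: adj_def)
    have "\<not> graph_free H G"
    proof (rule embedding_imp_not_free[OF assms(1,4), of g])
      have "inj_on g (insert z (gverts ?F))"
        using f(1) gf(2) nuW by (fastforce simp: g_def VF inj_on_def)
      then show "inj_on g (gverts H)" using assms(2) by (simp add: VF insert_absorb)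
      show "g ` gverts H \<subseteq> gverts G"
        using gf W(1) sub assms(6) by (fastforce simp: g_def)
      fix x y assume xy: "x \<in> gverts H" "y \<in> gverts H" "{x, y} \<in> gedges H"
      have "x \<noteq> y" using xy(3) assms(1) by (auto simp: simple_graph_def)
      consider "x = z" | "y = z" | "x \<noteq> z" "y \<noteq> z" by blast
      then have "adj (g x) (g y)"
      proof cases
        case 1
        then show ?thesis using gf[of y] adju xy \<open>x \<noteq> y\<close> by (simp add: g_def)
      next
        case 2
        then show ?thesis using gf[of x] adju sym xy \<open>x \<noteq> y\<close> by (simp add: g_def)
      next
        case 3
        then show ?thesis using f(3)[of x y] gf xy by (simp add: VF) (auto simp: delete_vertex_def)
      qed
      then show "{g x, g y} \<in> gedges G" by (simp add: adj_def)
    qed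
    then show False using assms(5) by simp
  qed
  from degenerate_colouring[OF fin sym this] show ?thesis
    by (auto simp: adj_def)
qed

section \<open>Bounds on the theta function\<close>

lemma lovasz_theta_le: "theta_feasible F \<kappa> \<Longrightarrow> lovasz_theta F \<le> \<kappa>"
  unfolding lovasz_theta_def
  by (rule cInf_lower) (auto simp: theta_feasible_def bdd_below_def)

lemma graph_free_locally_colourable:
  assumes "simple_graph H" "z \<in> gverts H" "acyclic_graph (delete_vertex z H)"
    and "simple_graph G" "graph_free H G"
    and off: "\<forall>u\<in>gverts G. \<forall>v\<in>gverts G. u \<noteq> v \<longrightarrow> {u, v} \<notin> gedges G \<longrightarrow> N u v = 0"
  shows "locally_colourable (Suc (card (gverts H))) (gverts G) N"
  unfolding locally_colourable_def
proof
  let ?h = "card (gverts H)" and ?V = "gverts G"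
  fix u assume u: "u \<in> ?V"
  obtain col :: "'b \<Rightarrow> nat" where lt: "\<forall>v. {u, v} \<in> gedges G \<longrightarrow> col v < ?h"
    and proper: "\<forall>v w. {u, v} \<in> gedges G \<longrightarrow> {u, w} \<in> gedges G \<longrightarrow> v \<noteq> w \<longrightarrow>
      {v, w} \<in> gedges G \<longrightarrow> col v \<noteq> col w"
    using neighbourhood_colouring[OF assms(1-5) u] by blast
  \<comment> \<open>The entry \<open>N u u\<close> may be nonzero, so \<open>u\<close> gets a colour
    of its own, which no neighbour uses; this accounts for the \<open>Suc\<close>.\<close>
  define c where "c v = (if v = u then ?h else col v)" for v
  have nb: "{u, v} \<in> gedges G" if "v \<in> ?V" "N u v \<noteq> 0" "v \<noteq> u" for v
    using off[rule_format, OF u that(1)] that(2,3) by auto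
  have "c v < Suc ?h" if "v \<in> ?V" "N u v \<noteq> 0" for v
    using nb[OF that] lt by (auto simp: c_def less_Suc_eq)
  moreover have "N v v' = 0"
    if v: "v \<in> ?V" "N u v \<noteq> 0" "v' \<in> ?V" "N u v' \<noteq> 0" "v \<noteq> v'" "c v = c v'" for v v'
  proof -
    have "v \<noteq> u \<and> v' \<noteq> u"
      using nb[of v] nb[of v'] lt v by (auto simp: c_def split: if_splits)
    moreover from this have "{v, v'} \<notin> gedges G"
      using nb[of v] nb[of v'] proper v by (auto simp: c_def)
    ultimately show ?thesis using off[rule_format, OF v(1,3,5)] by simp
  qed
  ultimately have "\<forall>v\<in>?V. N u v \<noteq> 0 \<longrightarrow> c v < Suc ?h \<and>
      (\<forall>v'\<in>?V. N u v' \<noteq> 0 \<longrightarrow> v \<noteq> v' \<longrightarrow> c v = c v' \<longrightarrow> N v v' = 0)" by simp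
  then show "\<exists>c :: 'b \<Rightarrow> nat. \<forall>v\<in>?V. N u v \<noteq> 0 \<longrightarrow> c v < Suc ?h \<and>
      (\<forall>v'\<in>?V. N u v' \<noteq> 0 \<longrightarrow> v \<noteq> v' \<longrightarrow> c v = c v' \<longrightarrow> N v v' = 0)"
    by (rule exI[of _ c])
qed

lemma normalised_certificate:
  assumes "simple_graph G" "2 \<le> \<kappa>" "\<not> theta_feasible (graph_complement G) \<kappa>"
  obtains N w where "psd (gverts G) N" "\<forall>v\<in>gverts G. N v v \<le> 1"
    "(\<Sum>v\<in>gverts G. (w v)\<^sup>2) = 1" "\<kappa> \<le> qform (gverts G) N w w"
    "\<forall>u\<in>gverts G. \<forall>v\<in>gverts G. u \<noteq> v \<longrightarrow> {u, v} \<notin> gedges G \<longrightarrow> N u v = 0"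
proof -
  have fin: "finite (gverts G)" using assms(1) by (simp add: simple_graph_def)
  obtain Y where Y: "psd (gverts G) Y"
    "\<forall>u\<in>gverts G. \<forall>v\<in>gverts G. u \<noteq> v \<longrightarrow> {u, v} \<notin> gedges G \<longrightarrow> Y u v = 0"
    "(\<Sum>v\<in>gverts G. Y v v) = 1" "\<kappa> \<le> (\<Sum>u\<in>gverts G. \<Sum>v\<in>gverts G. Y u v)"
    using theta_infeasible_certificate[OF assms] by blast
  obtain N w where N: "psd (gverts G) N" "\<forall>v\<in>gverts G. N v v \<le> 1"
    "(\<Sum>v\<in>gverts G. (w v)\<^sup>2) = 1" "\<forall>u v. Y u v = 0 \<longrightarrow> N u v = 0"
    "(\<Sum>u\<in>gverts G. \<Sum>v\<in>gverts G. Y u v) = qform (gverts G) N w w"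
    using psd_normalise[OF fin Y(1,3)] by blast
  show thesis
    by (rule that[OF N(1,2,3)]) (use Y N in auto)
qed

section \<open>Degree counting and the two bounds\<close>

definition degree :: "'a sgraph \<Rightarrow> 'a \<Rightarrow> nat" where
  "degree G v = card {e \<in> gedges G. v \<in> e}"

lemma finite_gedges: "simple_graph G \<Longrightarrow> finite (gedges G)"
  by (rule finite_subset[of _ "Pow (gverts G)"]) (auto simp: simple_graph_def)

lemma sum_degree:
  assumes "simple_graph G"
  shows "(\<Sum>v\<in>gverts G. degree G v) = 2 * card (gedges G)"
  unfolding degree_def
proof (rule sum_multicount)
  show "finite (gverts G)" using assms by (simp add: simple_graph_def)
  show "finite (gedges G)" using assms by (rule finite_gedges)
  show "\<forall>e\<in>gedges G. card {v \<in> gverts G. v \<in> e} = 2"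
  proof
    fix e assume "e \<in> gedges G"
    then have "{v \<in> gverts G. v \<in> e} = e" "card e = 2"
      using assms by (auto simp: simple_graph_def)
    then show "card {v \<in> gverts G. v \<in> e} = 2" by simp
  qed
qed

lemma card_neighbours_le_degree:
  assumes "simple_graph G"
  shows "card {v. {u, v} \<in> gedges G} \<le> degree G u"
  unfolding degree_def
proof (rule card_inj_on_le[of "\<lambda>v. {u, v}"])
  show "inj_on (\<lambda>v. {u, v}) {v. {u, v} \<in> gedges G}"
    by (auto simp: inj_on_def doubleton_eq_iff)
  show "finite {e \<in> gedges G. u \<in> e}" using finite_gedges[OF assms] by simp
qed auto

text \<open>With \<open>t\<close> the cube root of \<open>n\<close>, a certificate would have form
  value at most \<open>K * t\<close> by \<open>cubic_bound\<close>. The larger constant is the one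
  that the edge bound requires.\<close>

lemma theta_feasible_vertex_bound:
  assumes "simple_graph H" "z \<in> gverts H" "acyclic_graph (delete_vertex z H)"
    and "simple_graph G" "graph_free H G" "card (gverts G) = n" "n > 0"
    and K: "K = Suc (card (gverts H))"
  shows "theta_feasible (graph_complement G) ((8 * real K + 2) * real n powr (1 / 3))"
proof (rule ccontr)
  define t where "t = real n powr (1 / 3)"
  have t: "t \<ge> 1" "t ^ 3 = n"
    using assms(7) by (auto simp: t_def ge_one_powr_ge_zero simp flip: powr_numeral powr_powr)
      (simp add: powr_powr)
  assume "\<not> ?thesis"
  then have infeasible: "\<not> theta_feasible (graph_complement G) ((8 * real K + 2) * t)"
    by (simp add: t_def)
  have "2 \<le> (8 * real K + 2) * t" using t mult_mono[of 2 "8 * real K + 2" 1 t] by simp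
  then obtain N w where N: "psd (gverts G) N" "\<forall>v\<in>gverts G. N v v \<le> 1"
    "(\<Sum>v\<in>gverts G. (w v)\<^sup>2) = 1" "(8 * real K + 2) * t \<le> qform (gverts G) N w w"
    "\<forall>u\<in>gverts G. \<forall>v\<in>gverts G. u \<noteq> v \<longrightarrow> {u, v} \<notin> gedges G \<longrightarrow> N u v = 0"
    using normalised_certificate[OF assms(4) _ infeasible] by blast
  have "locally_colourable K (gverts G) N"
    unfolding K by (rule graph_free_locally_colourable[OF assms(1-5) N(5)])
  moreover have "finite (gverts G)" using assms(4) by (simp add: simple_graph_def)
  ultimately have "qform (gverts G) N w w ^ 3 \<le> t ^ 3 * real K ^ 2"
    using cubic_bound[of "gverts G" N K w] N assms(6) t(2) by simp
  also have "\<dots> \<le> t ^ 3 * real K ^ 3"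
    using t(1) K by (intro mult_left_mono power_increasing) auto
  also have "\<dots> = (real K * t) ^ 3" by (simp add: power_mult_distrib)
  also have "\<dots> < ((8 * real K + 2) * t) ^ 3"
    using t(1) by (intro power_strict_mono mult_strict_right_mono) auto
  also have "\<dots> \<le> qform (gverts G) N w w ^ 3"
    using N(4) t(1) by (intro power_mono) auto
  finally show False by simp
qed

text \<open>Vertices of degree at most \<open>t\<^sup>2\<close> are handled by
  \<open>bounded_degree_bound\<close>; at most \<open>2 * t ^ 3\<close> others remain, where
  \<open>cubic_bound\<close> applies. Each part gives at most \<open>2 * K * t\<close>, and
  \<open>psd_add_bound\<close> doubles their sum to \<open>8 * K * t\<close>; the extra 2 in the
  constant makes the contradiction strict.\<close>

lemma theta_feasible_edge_bound:
  assumes "simple_graph H" "z \<in> gverts H" "acyclic_graph (delete_vertex z H)"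
    and "simple_graph G" "graph_free H G" "card (gedges G) = m" "m > 0"
    and K: "K = Suc (card (gverts H))"
  shows "theta_feasible (graph_complement G) ((8 * real K + 2) * real m powr (1 / 5))"
proof (rule ccontr)
  let ?V = "gverts G"
  define t where "t = real m powr (1 / 5)"
  have t: "t \<ge> 1" "t ^ 5 = m"
    using assms(7) by (auto simp: t_def ge_one_powr_ge_zero simp flip: powr_numeral powr_powr)
      (simp add: powr_powr)
  assume "\<not> ?thesis"
  then have infeasible: "\<not> theta_feasible (graph_complement G) ((8 * real K + 2) * t)"
    by (simp add: t_def)
  have "2 \<le> (8 * real K + 2) * t" using t mult_mono[of 2 "8 * real K + 2" 1 t] by simp
  then obtain N w where N: "psd ?V N" "\<forall>v\<in>?V. N v v \<le> 1"
    "(\<Sum>v\<in>?V. (w v)\<^sup>2) = 1" "(8 * real K + 2) * t \<le> qform ?V N w w"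
    "\<forall>u\<in>?V. \<forall>v\<in>?V. u \<noteq> v \<longrightarrow> {u, v} \<notin> gedges G \<longrightarrow> N u v = 0"
    using normalised_certificate[OF assms(4) _ infeasible] by blast
  have lc: "locally_colourable K ?V N"
    unfolding K by (rule graph_free_locally_colourable[OF assms(1-5) N(5)])
  have fin: "finite ?V" using assms(4) by (simp add: simple_graph_def)
  have w: "(\<Sum>v\<in>U. (w v)\<^sup>2) \<le> 1" if "U \<subseteq> ?V" for U
    unfolding N(3)[symmetric] using that fin by (intro sum_mono2) auto
  have K1: "1 \<le> real K" using K by simp
  \<comment> \<open>Both parts contribute \<open>O(m powr (1/5))\<close> exactly when the degree threshold is \<open>m powr (2/5)\<close>.\<close>
  define L where "L = {v \<in> ?V. real (degree G v) \<le> t\<^sup>2}"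
  define U where "U = {v \<in> ?V. t\<^sup>2 < real (degree G v)}"
  have sub: "L \<subseteq> ?V" "U \<subseteq> ?V" by (auto simp: L_def U_def)
  have low: "qform L N w w \<le> 2 * K * t"
  proof -
    \<comment> \<open>The added 1 counts the diagonal entry in each row of \<open>N\<close>.\<close>
    have "qform L N w w \<le> sqrt ((t\<^sup>2 + 1) * K)"
    proof (rule bounded_degree_bound)
      show "finite L" using sub fin by (auto intro: finite_subset)
      show "psd L N" using psd_subset N(1) fin sub by blast
      show "N v v \<le> 1" if "v \<in> L" for v using N(2) sub that by blast
      show "locally_colourable K L N" using locally_colourable_subset lc sub by blast
      fix u assume u: "u \<in> L"
      let ?nb = "{v. {u, v} \<in> gedges G}"
      have "finite ?nb"
        using assms(4) by (intro finite_subset[OF _ fin]) (auto simp: simple_graph_def)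
      moreover have "{v \<in> L. N u v \<noteq> 0} \<subseteq> insert u ?nb"
        using N(5)[rule_format, of u] sub(1) u by fastforce
      ultimately have "card {v \<in> L. N u v \<noteq> 0} \<le> card (insert u ?nb)"
        by (intro card_mono) auto
      also have "\<dots> \<le> Suc (card ?nb)" by (rule card_insert_le_m1) simp_all
      also have "\<dots> \<le> Suc (degree G u)"
        using card_neighbours_le_degree[OF assms(4)] by simp
      finally show "real (card {v \<in> L. N u v \<noteq> 0}) \<le> t\<^sup>2 + 1"
        using u by (simp add: L_def)
    qed (use w[OF sub(1)] in auto)
    also have "\<dots> \<le> sqrt ((2 * K * t)\<^sup>2)"
    proof (rule real_sqrt_le_mono)
      have "t\<^sup>2 + 1 \<le> 4 * t\<^sup>2"
        using one_le_power[OF t(1), of 2] by linarith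
      moreover have "real K \<le> real K * real K" using K1 by simp
      ultimately have "(t\<^sup>2 + 1) * K \<le> (4 * t\<^sup>2) * (real K * real K)"
        by (intro mult_mono) auto
      then show "(t\<^sup>2 + 1) * K \<le> (2 * K * t)\<^sup>2"
        by (simp add: power2_eq_square mult_ac)
    qed
    also have "\<dots> = 2 * K * t" using t(1) by simp
    finally show ?thesis .
  qed
  have high: "qform U N w w \<le> 2 * K * t"
  proof -
    \<comment> \<open>Double counting: the degrees sum to \<open>2 * m\<close>, which is
      \<open>2 * t ^ 5\<close>, and each vertex of \<open>U\<close> contributes at least
      \<open>t\<^sup>2\<close>.\<close>
    have "real (card U) * t\<^sup>2 \<le> (\<Sum>v\<in>U. real (degree G v))"
      using sum_bounded_below[of U "t\<^sup>2" "\<lambda>v. real (degree G v)"] by (simp add: U_def)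
    also have "\<dots> \<le> (\<Sum>v\<in>?V. real (degree G v))"
      using fin sub by (intro sum_mono2) auto
    also have "\<dots> = 2 * m"
      using sum_degree[OF assms(4)] assms(6) by (simp flip: of_nat_sum)
    also have "real (2 * m) = (2 * t ^ 3) * t\<^sup>2"
      using t(2) by (simp flip: power_add)
    finally have card: "card U \<le> 2 * t ^ 3" using t(1) by simp
    have "qform U N w w ^ 3 \<le> card U * real K ^ 2"
    proof (rule cubic_bound)
      show "finite U" using sub fin by (auto intro: finite_subset)
      show "psd U N" using psd_subset N(1) fin sub by blast
      show "N v v \<le> 1" if "v \<in> U" for v using N(2) sub that by blast
      show "locally_colourable K U N" using locally_colourable_subset lc sub by blast
    qed (use w[OF sub(2)] in auto)
    also have "\<dots> \<le> (2 * t ^ 3) * real K ^ 3"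
      using card t(1) K1 by (intro mult_mono power_increasing) auto
    also have "\<dots> \<le> (2 * K * t) ^ 3"
      using t(1) by (simp add: power_mult_distrib)
    finally show ?thesis
      using t(1) by (auto intro: power_le_imp_le_base[of _ 2] simp: numeral_3_eq_3)
  qed
  have "qform ?V N w w
     = qform ?V N (\<lambda>u. (if u \<in> L then w u else 0) + (if u \<in> U then w u else 0))
         (\<lambda>u. (if u \<in> L then w u else 0) + (if u \<in> U then w u else 0))"
    by (intro qform_cong) (auto simp: L_def U_def)
  also have "\<dots> \<le> 2 * qform L N w w + 2 * qform U N w w"
    using psd_add_bound[OF N(1)] unfolding qform_subset[OF fin sub(1)] qform_subset[OF fin sub(2)] .
  also have "\<dots> \<le> 8 * K * t" using low high by simp
  finally show False using N(4) t(1) by (simp add: algebra_simps)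
qed

theorem theorem3p8:
  fixes H :: "'b sgraph"
  assumes "simple_graph H"
    and "\<exists>v \<in> gverts H. acyclic_graph (delete_vertex v H)"
  shows "\<exists>C :: real. C > 0 \<and>
    (\<forall>n :: nat. n > 0 \<longrightarrow> lambda_theta n H \<le> ereal (C * real n powr (1 / 3))) \<and>
    (\<forall>m :: nat. m > 0 \<longrightarrow> mu_theta m H \<le> ereal (C * real m powr (1 / 5)))"
proof -
  obtain z where z: "z \<in> gverts H" "acyclic_graph (delete_vertex z H)"
    using assms(2) by blast
  define K where "K = Suc (card (gverts H))"
  \<comment> \<open>Bounding the supremum by all its members also covers an empty family, whose
    supremum is minus infinity.\<close>
  have "lambda_theta n H \<le> ereal ((8 * real K + 2) * real n powr (1 / 3))" if "n > 0" for n
    unfolding lambda_theta_def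
  proof (rule Sup_least)
    fix x
    assume "x \<in> {ereal (lovasz_theta (graph_complement G)) | G :: nat sgraph.
        simple_graph G \<and> graph_free H G \<and> card (gverts G) = n}"
    then obtain G :: "nat sgraph" where x: "x = ereal (lovasz_theta (graph_complement G))"
      and G: "simple_graph G" "graph_free H G" "card (gverts G) = n" by blast
    show "x \<le> ereal ((8 * real K + 2) * real n powr (1 / 3))"
      unfolding x ereal_less_eq(3)
      by (rule lovasz_theta_le[OF theta_feasible_vertex_bound[OF assms(1) z G that K_def]])
  qed
  moreover have "mu_theta m H \<le> ereal ((8 * real K + 2) * real m powr (1 / 5))" if "m > 0" for m
    unfolding mu_theta_def
  proof (rule Sup_least)
    fix x
    assume "x \<in> {ereal (lovasz_theta (graph_complement G)) | G :: nat sgraph.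
        simple_graph G \<and> graph_free H G \<and> card (gedges G) = m}"
    then obtain G :: "nat sgraph" where x: "x = ereal (lovasz_theta (graph_complement G))"
      and G: "simple_graph G" "graph_free H G" "card (gedges G) = m" by blast
    show "x \<le> ereal ((8 * real K + 2) * real m powr (1 / 5))"
      unfolding x ereal_less_eq(3)
      by (rule lovasz_theta_le[OF theta_feasible_edge_bound[OF assms(1) z G that K_def]])
  qed
  ultimately show ?thesis
    by (intro exI[of _ "8 * real K + 2"]) auto
qed

end
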